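(* For all $n\ge 3$, $\operatorname{ext}_D(C_n)\le \operatorname{ext}_D(\mathbb{S}^1)\le 16$.
   Context: $\mathbb{S}^1$ is identified with $\mathbb{R}/\mathbb{Z}$, with automorphism group consisting of rotations $x\mapsto x+\alpha$ and reflections $x\mapsto\beta-x$. $C_n$ is the $n$-vertex cycle with its dihedral automorphism group. For a group $\Gamma$ acting on $X$, a coloring is distinguishing if the only element of $\Gamma$ preserving it is the identity; $D_\Gamma(X)$ is the least number of colors admitting a distinguishing coloring. A set $S\subseteq X$ is a fixing set if every non-identity element of $\Gamma$ moves some element of $S$. $\operatorname{ext}_D(X)$ is the minimum $m$ such that for every fixing set $W\subseteq X$ with $|W|\ge m$, every coloring $X\setminus W\to\{1,\dots,D_\Gamma(X)\}$ extends to a distinguishing $D_\Gamma(X)$-coloring of $X$. For $C_n$ this is taken with $\Gamma=\operatorname{Aut}(C_n)$ acting on $V(C_n)$, and for $\mathbb{S}^1$ with the group of rotations and reflections. *)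

theory Defs
  imports Complex_Main "HOL-Library.Extended_Nat" "HOL-Library.FuncSet"
    "HOL-Combinatorics.Permutations"
begin

text \<open>
  A group acting faithfully on \<open>X\<close> is represented by the set \<open>\<Gamma>\<close> of the maps by which it acts.
  Group elements are compared with the identity only on \<open>X\<close>.
\<close>

definition is_identity_on :: "'a set \<Rightarrow> ('a \<Rightarrow> 'a) \<Rightarrow> bool" where
  "is_identity_on X g \<longleftrightarrow> (\<forall>x\<in>X. g x = x)"

definition distinguishing :: "('a \<Rightarrow> 'a) set \<Rightarrow> 'a set \<Rightarrow> ('a \<Rightarrow> nat) \<Rightarrow> bool" where
  "distinguishing \<Gamma> X c \<longleftrightarrow>
     (\<forall>g\<in>\<Gamma>. (\<forall>x\<in>X. c (g x) = c x) \<longrightarrow> is_identity_on X g)"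

text \<open>The infimum in \<^typ>\<open>enat\<close> is attained if the set is nonempty, and is \<open>\<infinity>\<close> otherwise.\<close>

definition distinguishing_number :: "('a \<Rightarrow> 'a) set \<Rightarrow> 'a set \<Rightarrow> enat" where
  "distinguishing_number \<Gamma> X =
     Inf {enat k |k. \<exists>c \<in> X \<rightarrow> {1..k}. distinguishing \<Gamma> X c}"

definition colors :: "('a \<Rightarrow> 'a) set \<Rightarrow> 'a set \<Rightarrow> nat set" where
  "colors \<Gamma> X = {i. 1 \<le> i \<and> enat i \<le> distinguishing_number \<Gamma> X}"

definition fixing_set :: "('a \<Rightarrow> 'a) set \<Rightarrow> 'a set \<Rightarrow> 'a set \<Rightarrow> bool" where
  "fixing_set \<Gamma> X W \<longleftrightarrow>
     W \<subseteq> X \<and> (\<forall>g\<in>\<Gamma>. \<not> is_identity_on X g \<longrightarrow> (\<exists>w\<in>W. g w \<noteq> w))"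

text \<open>Infinite sets \<open>W\<close> satisfy \<open>|W| \<ge> m\<close> for every \<open>m\<close>, whereas \<^const>\<open>card\<close> sends them to \<open>0\<close>.\<close>

definition ext_D :: "('a \<Rightarrow> 'a) set \<Rightarrow> 'a set \<Rightarrow> enat" where
  "ext_D \<Gamma> X =
     Inf {enat m |m. \<forall>W. fixing_set \<Gamma> X W \<and> (infinite W \<or> m \<le> card W) \<longrightarrow>
       (\<forall>c \<in> (X - W) \<rightarrow> colors \<Gamma> X.
          \<exists>c' \<in> X \<rightarrow> colors \<Gamma> X. (\<forall>x \<in> X - W. c' x = c x) \<and> distinguishing \<Gamma> X c')}"

definition graph_automorphisms :: "'a set \<Rightarrow> ('a \<Rightarrow> 'a \<Rightarrow> bool) \<Rightarrow> ('a \<Rightarrow> 'a) set" where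
  "graph_automorphisms V adj =
     {f. f permutes V \<and> (\<forall>u\<in>V. \<forall>v\<in>V. adj (f u) (f v) \<longleftrightarrow> adj u v)}"

definition cycle_vertices :: "nat \<Rightarrow> nat set" where
  "cycle_vertices n = {0..<n}"

definition cycle_adj :: "nat \<Rightarrow> nat \<Rightarrow> nat \<Rightarrow> bool" where
  "cycle_adj n u v \<longleftrightarrow> v = (u + 1) mod n \<or> u = (v + 1) mod n"

definition cycle_automorphisms :: "nat \<Rightarrow> (nat \<Rightarrow> nat) set" where
  "cycle_automorphisms n = graph_automorphisms (cycle_vertices n) (cycle_adj n)"

quotient_type circle = real / "\<lambda>x y. x - y \<in> \<int>"
proof (rule equivpI)
  show "reflp (\<lambda>x y::real. x - y \<in> \<int>)"
    by (simp add: reflp_def)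
  show "symp (\<lambda>x y::real. x - y \<in> \<int>)"
    unfolding symp_def by (metis Ints_minus minus_diff_eq)
  show "transp (\<lambda>x y::real. x - y \<in> \<int>)"
    unfolding transp_def by (metis Ints_add diff_add_cancel add_diff_eq)
qed

instantiation circle :: ab_group_add
begin

lift_definition zero_circle :: circle is 0 .

lift_definition plus_circle :: "circle \<Rightarrow> circle \<Rightarrow> circle" is "(+)"
  using Ints_add by (fastforce simp: algebra_simps)

lift_definition uminus_circle :: "circle \<Rightarrow> circle" is uminus
  using Ints_minus by (fastforce simp: algebra_simps)

lift_definition minus_circle :: "circle \<Rightarrow> circle \<Rightarrow> circle" is "(-)"
  using Ints_diff by (fastforce simp: algebra_simps)

instance
  by standard (transfer; simp add: algebra_simps)+

end

definition circle_automorphisms :: "(circle \<Rightarrow> circle) set" where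
  "circle_automorphisms = {(\<lambda>x. x + \<alpha>) |\<alpha>. True} \<union> {(\<lambda>x. \<beta> - x) |\<beta>. True}"

end

theory Submission
  imports Defs
begin

text \<open>
  For the upper bound, precolor everything outside a set \<open>W\<close> of 16 points and count the
  \<open>2 ^ 16\<close> extensions that some nontrivial automorphism preserves. An automorphism with \<open>f\<close> fixed
  points in \<open>W\<close> preserves at most \<open>2 ^ ((16 + f) div 2)\<close> of them, so the reflections \<open>x \<mapsto> b - x\<close> with
  \<open>b \<in> W + W\<close> account for at most \<open>16 * 2 ^ 9 + 120 * 2 ^ 8\<close> extensions, and the rotations of order at
  most 32, each generating the same group as some \<open>x \<mapsto> x + 1/q\<close>, for at most \<open>31 * 2 ^ 8\<close>.
  The remaining automorphisms are infinitely many, but transporting the color of a point of \<open>W\<close> along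
  different products of such automorphisms, with all intermediate points outside \<open>W\<close>, forces the
  extensions preserved by them to coincide: all rotations of order more than 32 together preserve at
  most one extension, and all reflections with \<open>b \<notin> W + W\<close> at most \<open>2 * 16\<^sup>2 + 1\<close>. The total is less
  than \<open>2 ^ 16\<close>.

  The cycle is embedded in the circle as the multiples of \<open>1/n\<close>, its automorphisms being restrictions
  of those of the circle. For \<open>n \<ge> 6\<close> both objects need two colors and precolorings of the cycle extend
  to precolorings of the circle. For \<open>n \<le> 5\<close> the cycle needs three colors, and every precoloring
  outside at least three vertices extends.
\<close>

subsection \<open>Counting invariant extensions\<close>

text \<open>Total functions, so that a point can be moved from \<open>W\<close> into the precoloring
  by updating \<open>c\<close>; the counting induction proceeds in this way.\<close>

definition extensions :: "'a set \<Rightarrow> ('a \<Rightarrow> nat) \<Rightarrow> ('a \<Rightarrow> nat) set" where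
  "extensions W c = {F. (\<forall>x. x \<notin> W \<longrightarrow> F x = c x) \<and> (\<forall>x\<in>W. F x \<in> {1, 2})}"

definition invariant_extensions ::
    "('a \<Rightarrow> 'a) \<Rightarrow> 'a set \<Rightarrow> ('a \<Rightarrow> nat) \<Rightarrow> ('a \<Rightarrow> nat) set" where
  "invariant_extensions g W c = {F \<in> extensions W c. \<forall>x. F (g x) = F x}"

lemma extensions_bij:
  "bij_betw (\<lambda>F x. if x \<in> W then F x else c x) (W \<rightarrow>\<^sub>E {1, 2}) (extensions W c)"
  by (rule bij_betw_byWitness[where f' = "\<lambda>F. restrict F W"])
    (auto simp: extensions_def fun_eq_iff PiE_def extensional_def restrict_def)

lemma card_extensions:
  assumes "finite W"
  shows "card (extensions W c) = 2 ^ card W"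
  using bij_betw_same_card[OF extensions_bij, of W c] card_PiE[OF assms, of "\<lambda>_. {1, 2::nat}"]
  by (simp add: numeral_2_eq_2)

lemma finite_extensions: "finite W \<Longrightarrow> finite (extensions W c)"
  using bij_betw_finite[OF extensions_bij, of W c] finite_PiE[of W "\<lambda>_. {1, 2::nat}"] by simp

lemma finite_invariant_extensions: "finite W \<Longrightarrow> finite (invariant_extensions g W c)"
  by (rule finite_subset[OF _ finite_extensions]) (auto simp: invariant_extensions_def)

text \<open>Induction on \<open>W\<close>. A fixed point of \<open>g\<close> in \<open>W\<close>
  admits two colors and lowers the exponent by one. In the absence of fixed points, a point sent out
  of \<open>W\<close> has its color forced, and a point sent to another point of \<open>W\<close>
  shares its color with it, so that two points cost a single factor 2.\<close>

lemma card_invariant_extensions_le: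
  assumes "finite W"
  shows "card (invariant_extensions g W c) \<le> 2 ^ ((card W + card {w \<in> W. g w = w}) div 2)"
  using assms
proof (induction "card W" arbitrary: W c rule: less_induct)
  case less
  note fin = \<open>finite W\<close>
  let ?I = "invariant_extensions g"
  let ?e = "\<lambda>W. (card W + card {w \<in> W. g w = w}) div 2"
  consider "W = {}" | w where "w \<in> W" "g w = w"
    | w where "\<forall>w\<in>W. g w \<noteq> w" "w \<in> W" "g w \<notin> W"
    | w where "\<forall>w\<in>W. g w \<noteq> w" "w \<in> W" "g w \<in> W" "g w \<noteq> w"
    by blast
  then show ?case
  proof cases
    case 1
    have "?I W c \<subseteq> {c}"
      using 1 by (auto simp: invariant_extensions_def extensions_def)
    then have "card (?I W c) \<le> 1"
      using card_mono[of "{c}"] by simp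
    then show ?thesis using 1 by simp
  next
    case 2
    let ?V = "W - {w}"
    have sub: "?I W c \<subseteq> ?I ?V (c(w := 1)) \<union> ?I ?V (c(w := 2))"
      using 2 by (auto simp: invariant_extensions_def extensions_def)
    have cV: "card W = Suc (card ?V)" using 2 fin card.remove by fastforce
    have "{v \<in> W. g v = v} = insert w {v \<in> ?V. g v = v}" using 2 by auto
    then have "card {v \<in> W. g v = v} = Suc (card {v \<in> ?V. g v = v})" using fin by simp
    then have e: "?e W = Suc (?e ?V)" using cV by simp
    have IH: "card (?I ?V d) \<le> 2 ^ ?e ?V" for d
      using less.hyps[of ?V d] cV fin by simp
    have "card (?I W c) \<le> card (?I ?V (c(w := 1)) \<union> ?I ?V (c(w := 2)))"
      by (rule card_mono[OF _ sub]) (simp add: finite_invariant_extensions fin)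
    also have "\<dots> \<le> 2 ^ ?e ?V + 2 ^ ?e ?V"
      by (rule order_trans[OF card_Un_le]) (intro add_mono IH)
    finally show ?thesis unfolding e by simp
  next
    case 3
    let ?V = "W - {w}"
    have sub: "?I W c \<subseteq> ?I ?V (c(w := c (g w)))"
      using 3 by (auto simp: invariant_extensions_def extensions_def)
    have cV: "card W = Suc (card ?V)" using 3 fin card.remove by fastforce
    have e: "?e ?V \<le> ?e W"
      using cV fin by (intro div_le_mono add_mono card_mono) auto
    have "card (?I W c) \<le> card (?I ?V (c(w := c (g w))))"
      by (rule card_mono[OF _ sub]) (simp add: finite_invariant_extensions fin)
    also have "\<dots> \<le> 2 ^ ?e ?V"
      using less.hyps[of ?V] cV fin by simp
    also have "\<dots> \<le> 2 ^ ?e W" by (rule power_increasing[OF e]) simp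
    finally show ?thesis .
  next
    case 4
    let ?V = "W - {w, g w}"
    let ?d = "\<lambda>k. c(w := k, g w := k)"
    have sub: "?I W c \<subseteq> ?I ?V (?d 1) \<union> ?I ?V (?d 2)"
    proof
      fix F assume F: "F \<in> ?I W c"
      then have "F w \<in> {1, 2}" using 4 by (auto simp: invariant_extensions_def extensions_def)
      moreover have "F (g w) = F w" using F by (auto simp: invariant_extensions_def)
      moreover have "F \<in> ?I ?V (?d (F w))"
        using F 4 calculation(2) by (auto simp: invariant_extensions_def extensions_def)
      ultimately show "F \<in> ?I ?V (?d 1) \<union> ?I ?V (?d 2)" by auto
    qed
    have "card {w, g w} \<le> card W" using 4 fin by (intro card_mono) auto
    moreover have "card ?V = card W - card {w, g w}"
      using 4 fin by (intro card_Diff_subset) auto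
    moreover have "card {w, g w} = 2" using 4 by auto
    ultimately have cV: "card W = Suc (Suc (card ?V))" by simp
    have none: "{v \<in> W. g v = v} = {}" "{v \<in> ?V. g v = v} = {}" using 4 by auto
    have e: "?e W = Suc (?e ?V)" unfolding none using cV by simp
    have IH: "card (?I ?V d) \<le> 2 ^ ?e ?V" for d
      using less.hyps[of ?V d] cV fin by simp
    have "card (?I W c) \<le> card (?I ?V (?d 1) \<union> ?I ?V (?d 2))"
      by (rule card_mono[OF _ sub]) (simp add: finite_invariant_extensions fin)
    also have "\<dots> \<le> 2 ^ ?e ?V + 2 ^ ?e ?V"
      by (rule order_trans[OF card_Un_le]) (intro add_mono IH)
    finally show ?thesis unfolding e by simp
  qed
qed

lemma card_UN_le_mult:
  assumes "finite I" "\<And>i. i \<in> I \<Longrightarrow> card (A i) \<le> k" "card I \<le> m"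
  shows "card (\<Union>i\<in>I. A i) \<le> m * k"
proof -
  have "card (\<Union>i\<in>I. A i) \<le> (\<Sum>i\<in>I. card (A i))" by (rule card_UN_le[OF assms(1)])
  also have "\<dots> \<le> card I * k" using sum_bounded_above[of I "\<lambda>i. card (A i)" k] assms(2) by simp
  also have "\<dots> \<le> m * k" using assms(3) by simp
  finally show ?thesis .
qed

section \<open>Arithmetic of the circle group\<close>

lemma abs_circle_eq_iff: "abs_circle s = abs_circle t \<longleftrightarrow> s - t \<in> \<int>"
  by (rule circle.abs_eq_iff)

lemma abs_circle_add: "abs_circle (s + t) = abs_circle s + abs_circle t"
  by (simp add: plus_circle.abs_eq)

lemma abs_circle_0: "abs_circle 0 = 0"
  by (simp add: zero_circle_def)

lemma abs_circle_eq_0_iff: "abs_circle t = 0 \<longleftrightarrow> t \<in> \<int>"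
  using abs_circle_eq_iff[of t 0] by (simp add: abs_circle_0)

lemma circle_double_eq_0:
  fixes x :: circle
  assumes "x + x = 0"
  shows "x = 0 \<or> x = abs_circle (1/2)"
proof -
  obtain t where t: "x = abs_circle t" by (metis Quotient_circle Quotient_abs_rep)
  with assms have "t + t \<in> \<int>" by (simp add: abs_circle_add[symmetric] abs_circle_eq_0_iff)
  then obtain z :: int where z: "t + t = of_int z" by (auto elim: Ints_cases)
  show ?thesis
  proof (cases "even z")
    case True
    then obtain y where "z = 2 * y" by blast
    with z have "t = of_int y" by simp
    then show ?thesis by (simp add: t abs_circle_eq_0_iff)
  next
    case False
    then obtain y where "z = 2 * y + 1" by (blast elim: oddE)
    with z have "t - 1/2 = of_int y" by simp
    then show ?thesis by (simp add: t abs_circle_eq_iff)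
  qed
qed

text \<open>Two points with the same double differ by 0 or 1/2, so a third one has no room. Hence a
  reflection fixes at most two points.\<close>

lemma circle_half_unique:
  fixes x y z :: circle
  assumes "x + x = y + y" "y + y = z + z"
  shows "x = y \<or> y = z \<or> x = z"
proof -
  have "(x - y) + (x - y) = 0" "(z - y) + (z - y) = 0"
    using assms by (simp_all add: algebra_simps)
  then show ?thesis using circle_double_eq_0[of "x - y"] circle_double_eq_0[of "z - y"]
    by (metis eq_iff_diff_eq_0 diff_add_cancel)
qed

lemma card_reflection_fixpoints:
  fixes W :: "circle set"
  assumes "finite W"
  shows "card {w \<in> W. \<beta> - w = w} \<le> 2"
proof (rule ccontr)
  assume "\<not> ?thesis"
  then obtain S where S: "S \<subseteq> {w \<in> W. \<beta> - w = w}" "card S = 3"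
    using obtain_subset_with_card_n[of 3 "{w \<in> W. \<beta> - w = w}"] by auto
  then obtain x y z where "S = {x, y, z}" "x \<noteq> y" "y \<noteq> z" "x \<noteq> z"
    by (auto simp: card_3_iff)
  then show False using S(1) circle_half_unique[of x y z] by (auto simp: algebra_simps)
qed

lemma infinite_circle: "infinite (UNIV :: circle set)"
proof
  assume fin: "finite (UNIV :: circle set)"
  have "inj_on abs_circle {0<..<1::real}"
  proof (rule inj_onI)
    fix s t :: real assume st: "s \<in> {0<..<1}" "t \<in> {0<..<1}" "abs_circle s = abs_circle t"
    then obtain z :: int where z: "s - t = of_int z" by (auto simp: abs_circle_eq_iff elim: Ints_cases)
    with st have "real_of_int z < 1" "real_of_int z > -1" by auto
    then have "z = 0" by linarith
    with z show "s = t" by simp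
  qed
  then have "finite {0<..<1::real}" by (rule inj_on_finite[OF _ subset_UNIV fin])
  then show False using infinite_Ioo[of 0 "1::real"] by simp
qed

section \<open>Transport of colors along rotations and reflections\<close>

lemma rotation_multiple:
  fixes F :: "circle \<Rightarrow> 'b"
  assumes "\<And>x. F (x + abs_circle t) = F x"
  shows "F (x + abs_circle (of_int k * t)) = F x"
proof -
  have pos: "F (x + abs_circle (real m * t)) = F x" for m x
  proof (induction m arbitrary: x)
    case 0
    then show ?case by (simp add: abs_circle_0)
  next
    case (Suc m)
    have "x + abs_circle (real (Suc m) * t) = (x + abs_circle (real m * t)) + abs_circle t"
      by (simp add: distrib_right abs_circle_add add_ac)
    then show ?case using assms Suc by metis
  qed
  show ?thesis
  proof (cases "k \<ge> 0")
    case True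
    then show ?thesis using pos[of x "nat k"] by simp
  next
    case False
    let ?y = "x + abs_circle (of_int k * t)"
    have *: "?y + abs_circle (real (nat (-k)) * t) = x"
      using False by (simp add: add.assoc abs_circle_add[symmetric] abs_circle_0)
    show ?thesis using pos[of ?y "nat (-k)"] unfolding * by simp
  qed
qed

text \<open>With \<open>j = k * t\<close> and \<open>d = gcd j k\<close>, Bezout gives
  \<open>u * t + v = d / k\<close>, which is \<open>1 / q\<close> for \<open>k = d * q\<close>;
  \<open>q = 1\<close> would make \<open>t\<close> an integer. Invariance under rotation by
  \<open>t\<close> thus implies invariance under rotation by \<open>1 / q\<close>, which leaves one
  rotation per order to count.\<close>

lemma rational_rotation_generator:
  fixes t :: real
  assumes k: "k > 0" "real k * t \<in> \<int>" and t: "t \<notin> \<int>"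
  obtains q :: nat and u v :: int where "2 \<le> q" "q \<le> k" "of_int u * t + of_int v = 1 / real q"
proof -
  obtain j :: int where j: "real k * t = of_int j" using k(2) by (auto elim: Ints_cases)
  define d where "d = nat (gcd j (int k))"
  have dd: "int d = gcd j (int k)" by (simp add: d_def)
  have d0: "d > 0" using k(1) dd by (metis gcd_pos_int of_nat_0_less_iff less_numeral_extra(3))
  have "int d dvd int k" unfolding dd by simp
  then obtain q where q: "k = d * q" by (metis dvd_def of_nat_dvd_iff)
  obtain u v :: int where uv: "u * j + v * int k = gcd j (int k)" using bezout_int by blast
  have "(of_int u * t + of_int v) * real k = of_int u * (real k * t) + of_int v * real k"
    by (simp add: algebra_simps)
  also have "\<dots> = of_int (u * j + v * int k)" unfolding j by simp
  also have "\<dots> = real d" unfolding uv dd[symmetric] by simp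
  finally have *: "of_int u * t + of_int v = real d / real k" using k(1) by (simp add: field_simps)
  then have eq: "of_int u * t + of_int v = 1 / real q" using d0 by (simp add: q)
  have "q \<noteq> 1"
  proof
    assume "q = 1"
    then have "int k dvd j" using q dd by (metis gcd_dvd1 mult.right_neutral)
    then obtain y where "j = int k * y" by blast
    then have "t = of_int y" using j k(1) by simp
    then show False using t by simp
  qed
  moreover have "q \<noteq> 0" using q k(1) by auto
  moreover have "q \<le> k" using q d0 by simp
  ultimately show thesis using that[OF _ _ eq] by linarith
qed

text \<open>Pigeonhole: a coincidence among the \<open>N + 1\<close> translates of \<open>x\<close>
  by \<open>0, t, ..., N * t\<close> would make some \<open>k * t\<close> with
  \<open>1 \<le> k \<le> N\<close> an integer.\<close>

lemma multiple_avoiding: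
  fixes Z :: "circle set"
  assumes "finite Z" "card Z \<le> N" and t: "\<And>k. k \<in> {1..N} \<Longrightarrow> real k * t \<notin> \<int>"
  obtains k :: int where "x + abs_circle (of_int k * t) \<notin> Z"
proof -
  have ne: "abs_circle (real i * t) \<noteq> abs_circle (real j * t)" if "i < j" "j \<le> N" for i j
  proof
    assume "abs_circle (real i * t) = abs_circle (real j * t)"
    then have "real j * t - real i * t \<in> \<int>" by (metis abs_circle_eq_iff)
    moreover have "real j * t - real i * t = real (j - i) * t"
      using that by (simp add: of_nat_diff left_diff_distrib)
    ultimately have "real (j - i) * t \<in> \<int>" by simp
    moreover have "j - i \<in> {1..N}" using that by auto
    ultimately show False using t by blast
  qed
  let ?p = "\<lambda>k::nat. x + abs_circle (real k * t)"
  have inj: "inj_on ?p {0..N}"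
  proof (rule inj_onI)
    fix i j assume "i \<in> {0..N}" "j \<in> {0..N}" "?p i = ?p j"
    then show "i = j" using ne[of i j] ne[of j i] by (cases i j rule: linorder_cases) auto
  qed
  have "\<not> ?p ` {0..N} \<subseteq> Z"
  proof
    assume "?p ` {0..N} \<subseteq> Z"
    then have "card (?p ` {0..N}) \<le> card Z" by (rule card_mono[OF assms(1)])
    then show False using assms(2) card_image[OF inj] by simp
  qed
  then obtain k where "?p k \<notin> Z" by blast
  then show thesis using that[of "int k"] by simp
qed

text \<open>Rotations commute. Along the closed walk \<open>x\<close>, \<open>x + a\<close>,
  \<open>x + a + b\<close>, \<open>x + b\<close>, \<open>x\<close>, with \<open>a\<close> a multiple
  of \<open>s\<close> and \<open>b\<close> a multiple of \<open>t\<close>, the color is carried by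
  the invariance of \<open>F\<close>, \<open>G\<close>, \<open>F\<close>, \<open>G\<close> in turn.
  The switch between \<open>F\<close> and \<open>G\<close> is allowed at the three intermediate
  points because these lie outside \<open>W\<close>.\<close>

lemma large_order_rotations_agree:
  fixes W :: "circle set"
  assumes W: "finite W" "2 * card W \<le> N"
    and s: "\<And>k. k \<in> {1..N} \<Longrightarrow> real k * s \<notin> \<int>" "\<And>x. F (x + abs_circle s) = F x"
    and t: "\<And>k. k \<in> {1..N} \<Longrightarrow> real k * t \<notin> \<int>" "\<And>x. G (x + abs_circle t) = G x"
    and FG: "\<And>x. x \<notin> W \<Longrightarrow> F x = G x"
  shows "F = G"
proof
  fix x
  obtain k :: int where k: "x + abs_circle (of_int k * s) \<notin> W"
    using multiple_avoiding[of W N s x] W s(1) by auto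
  define a where "a = abs_circle (of_int k * s)"
  \<comment> \<open>One copy of \<open>W\<close> to be avoided by \<open>x + b\<close> and a
    translate to be avoided for the sake of \<open>x + b + a\<close>; hence the factor 2 in the
    bound on \<open>N\<close>.\<close>
  define Z where "Z = W \<union> (\<lambda>w. w - a) ` W"
  have "card Z \<le> card W + card W"
    unfolding Z_def using card_Un_le[of W] card_image_le[OF W(1), of "\<lambda>w. w - a"]
    by (meson add_left_mono order_trans)
  then obtain l :: int where l: "x + abs_circle (of_int l * t) \<notin> Z"
    using multiple_avoiding[of Z N t x] W t(1) by (auto simp: Z_def)
  define b where "b = abs_circle (of_int l * t)"
  have F: "F (y + a) = F y" for y unfolding a_def by (rule rotation_multiple[of F, OF s(2)])
  have G: "G (y + b) = G y" for y unfolding b_def by (rule rotation_multiple[of G, OF t(2)])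
  have out: "x + a \<notin> W" "x + b \<notin> W" "x + b + a \<notin> W"
    using k l by (auto simp: Z_def a_def b_def image_iff)
  have "F x = F (x + a)" using F by simp
  also have "\<dots> = G (x + a)" using FG out(1) by simp
  also have "\<dots> = G (x + b + a)" using G[of "x + a"] by (simp add: ac_simps)
  also have "\<dots> = F (x + b + a)" using FG out(3) by simp
  also have "\<dots> = F (x + b)" using F by simp
  also have "\<dots> = G (x + b)" using FG out(2) by simp
  also have "\<dots> = G x" using G by simp
  finally show "F x = G x" .
qed

text \<open>The products of the three reflections given by \<open>a\<close>, \<open>e\<close>,
  \<open>b\<close>, in this order and in the reverse order, are the same reflection, which sends
  \<open>x\<close> to \<open>y = a + b - e - x\<close>. Following a point \<open>x\<close> of
  \<open>W\<close> along both gives \<open>F x = G y\<close> and \<open>G x = F y\<close>, while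
  \<open>F\<close> and \<open>G\<close> agree at \<open>y\<close>. The conditions
  \<open>sums\<close> and \<open>diffs\<close> keep \<open>y\<close> and all intermediate points
  outside \<open>W\<close>.\<close>

lemma reflections_agree:
  fixes W :: "circle set"
  assumes F: "\<And>x. F (a - x) = F x" and G: "\<And>x. G (b - x) = G x" and H: "\<And>x. H (e - x) = H x"
    and FG: "\<And>x. x \<notin> W \<Longrightarrow> F x = H x" "\<And>x. x \<notin> W \<Longrightarrow> G x = H x"
    and sums: "\<And>v w. v \<in> W \<Longrightarrow> w \<in> W \<Longrightarrow> a \<noteq> v + w" "\<And>v w. v \<in> W \<Longrightarrow> w \<in> W \<Longrightarrow> b \<noteq> v + w"
      "\<And>v w. v \<in> W \<Longrightarrow> w \<in> W \<Longrightarrow> a + b - e \<noteq> v + w"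
    and diffs: "\<And>v w. v \<in> W \<Longrightarrow> w \<in> W \<Longrightarrow> a - e \<noteq> v - w" "\<And>v w. v \<in> W \<Longrightarrow> w \<in> W \<Longrightarrow> b - e \<noteq> v - w"
  shows "F = G"
proof
  fix x
  show "F x = G x"
  proof (cases "x \<in> W")
    case False
    then show ?thesis using FG by simp
  next
    case True
    define y where "y = a + b - e - x"
    have y: "y \<notin> W" using sums(3)[OF True, of y] by (auto simp: y_def)
    have a: "a - x \<notin> W" using sums(1)[OF True, of "a - x"] by auto
    have b: "b - x \<notin> W" using sums(2)[OF True, of "b - x"] by auto
    have ae: "e - (a - x) \<notin> W"
      using diffs(1)[OF True, of "e - (a - x)"] by (auto simp: algebra_simps)
    have be: "e - (b - x) \<notin> W"
      using diffs(2)[OF True, of "e - (b - x)"] by (auto simp: algebra_simps)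
    have "F x = H (a - x)" using F FG(1)[OF a] by simp
    also have "\<dots> = H (e - (a - x))" using H by simp
    also have "\<dots> = G (e - (a - x))" using FG(2)[OF ae] by simp
    also have "\<dots> = G (b - (e - (a - x)))" using G by simp
    also have "b - (e - (a - x)) = y" by (simp add: y_def algebra_simps)
    finally have 1: "F x = G y" .
    have "G x = H (b - x)" using G FG(2)[OF b] by simp
    also have "\<dots> = H (e - (b - x))" using H by simp
    also have "\<dots> = F (e - (b - x))" using FG(1)[OF be] by simp
    also have "\<dots> = F (a - (e - (b - x)))" using F by simp
    also have "a - (e - (b - x)) = y" by (simp add: y_def algebra_simps)
    finally have 2: "G x = F y" .
    show ?thesis using 1 2 FG y by simp
  qed
qed

section \<open>Counting the extensions preserved by each family of automorphisms\<close>

text \<open>The reflection sends every point of \<open>W\<close> out of \<open>W\<close>, so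
  precolored points determine all colors.\<close>

lemma card_reflection_invariant_outside_sums:
  fixes W :: "circle set"
  assumes b: "\<And>v w. v \<in> W \<Longrightarrow> w \<in> W \<Longrightarrow> b \<noteq> v + w"
  shows "card (invariant_extensions (\<lambda>x. b - x) W c) \<le> 1"
proof -
  have "invariant_extensions (\<lambda>x. b - x) W c \<subseteq> {\<lambda>x. if x \<in> W then c (b - x) else c x}"
  proof
    fix F assume F: "F \<in> invariant_extensions (\<lambda>x. b - x) W c"
    have "F x = (if x \<in> W then c (b - x) else c x)" for x
    proof (cases "x \<in> W")
      case True
      have "b - x \<notin> W" using b[OF True, of "b - x"] by auto
      moreover have "F (b - x) = F x" using F by (auto simp: invariant_extensions_def)
      ultimately show ?thesis using F True by (auto simp: invariant_extensions_def extensions_def)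
    next
      case False
      then show ?thesis using F by (auto simp: invariant_extensions_def extensions_def)
    qed
    then show "F \<in> {\<lambda>x. if x \<in> W then c (b - x) else c x}" by blast
  qed
  then show ?thesis using card_mono[of "{\<lambda>x. if x \<in> W then c (b - x) else c x}"] by fastforce
qed

text \<open>Fix one such extension \<open>H\<close>, preserved by the reflection given by
  \<open>e\<close>, and, if there is one, a second extension \<open>G\<close> preserved by none of
  the reflections in \<open>S\<close>, with its own \<open>b\<close>. By
  \<open>reflections_agree\<close>, every other extension has its reflection in one of two finite
  exceptional sets \<open>S\<close> and \<open>T\<close>, of at most \<open>(card W)\<^sup>2\<close>
  elements each, and each reflection there preserves at most one extension.\<close>

lemma card_reflections_outside_sums:
  fixes W :: "circle set"
  assumes W: "finite W"
  shows "card {F \<in> extensions W c.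
           \<exists>b. (\<forall>v\<in>W. \<forall>w\<in>W. b \<noteq> v + w) \<and> (\<forall>x. F (b - x) = F x)} \<le> 2 * (card W)\<^sup>2 + 1"
    (is "card ?R \<le> _")
proof -
  let ?I = "\<lambda>b. invariant_extensions (\<lambda>x. b - x) W c"
  define ok where "ok b \<longleftrightarrow> (\<forall>v\<in>W. \<forall>w\<in>W. b \<noteq> v + w)" for b
  have I1: "card (?I b) \<le> 1" if "ok b" for b
    using card_reflection_invariant_outside_sums that by (simp add: ok_def)
  have WW: "card ((\<lambda>(v, w). f v w) ` (W \<times> W)) \<le> (card W)\<^sup>2" for f :: "circle \<Rightarrow> circle \<Rightarrow> circle"
    using card_image_le[of "W \<times> W" "\<lambda>(v, w). f v w"] W
    by (simp add: card_cartesian_product power2_eq_square)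
  have IS: "card (\<Union>b\<in>{b \<in> (\<lambda>(v, w). f v w) ` (W \<times> W). ok b}. ?I b) \<le> (card W)\<^sup>2"
    for f :: "circle \<Rightarrow> circle \<Rightarrow> circle"
  proof -
    have "card (\<Union>b\<in>{b \<in> (\<lambda>(v, w). f v w) ` (W \<times> W). ok b}. ?I b) \<le> (card W)\<^sup>2 * 1"
    proof (rule card_UN_le_mult)
      show "card {b \<in> (\<lambda>(v, w). f v w) ` (W \<times> W). ok b} \<le> (card W)\<^sup>2"
        using W by (intro order_trans[OF card_mono WW[of f]]) auto
    qed (use W I1 in auto)
    then show ?thesis by simp
  qed
  have fin: "finite (\<Union>b\<in>{b \<in> (\<lambda>(v, w). f v w) ` (W \<times> W). ok b}. ?I b)"
    for f :: "circle \<Rightarrow> circle \<Rightarrow> circle"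
    using W by (intro finite_UN_I) (simp_all add: finite_invariant_extensions)
  define R where "R = ?R"
  have R: "F \<in> R \<longleftrightarrow> (\<exists>b. ok b \<and> F \<in> ?I b)" for F
    by (auto simp: R_def ok_def invariant_extensions_def)
  have "card R \<le> 2 * (card W)\<^sup>2 + 1"
  proof (cases "R = {}")
    case True
    show ?thesis unfolding True by simp
  next
    case False
    then obtain H e where H: "ok e" "H \<in> ?I e" using R by blast
    \<comment> \<open>The parameters that violate the \<open>diffs\<close> condition relative to
      \<open>e\<close>.\<close>
    define S where "S = {b \<in> (\<lambda>(v, w). e + (v - w)) ` (W \<times> W). ok b}"
    define US where "US = (\<Union>b\<in>S. ?I b)"
    have US: "finite US" "card US \<le> (card W)\<^sup>2"
      unfolding US_def S_def by (rule fin IS)+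
    show ?thesis
    proof (cases "R \<subseteq> US")
      case True
      then have "card R \<le> card US" by (rule card_mono[OF US(1)])
      then show ?thesis using US(2) by simp
    next
      case False
      then obtain G where G0: "G \<in> R" "G \<notin> US" by blast
      then obtain b where G: "ok b" "G \<in> ?I b" using R by blast
      have bS: "b \<notin> S" using G0(2) G(2) by (auto simp: US_def)
      \<comment> \<open>The parameters \<open>a\<close> for which \<open>a + b - e\<close> is a sum
        of two points of \<open>W\<close>, so that the endpoint \<open>y\<close> of the transport
        could lie in \<open>W\<close>.\<close>
      define T where "T = {a \<in> (\<lambda>(v, w). v + w - b + e) ` (W \<times> W). ok a}"
      define UT where "UT = (\<Union>b\<in>T. ?I b)"
      have UT: "finite UT" "card UT \<le> (card W)\<^sup>2"
        unfolding UT_def T_def by (rule fin IS)+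
      have "R \<subseteq> US \<union> {G} \<union> UT"
      proof
        fix F assume "F \<in> R"
        then obtain a where F: "ok a" "F \<in> ?I a" using R by blast
        show "F \<in> US \<union> {G} \<union> UT"
        proof (cases "a \<in> S \<or> a \<in> T")
          case True
          then show ?thesis using F(2) by (auto simp: US_def UT_def)
        next
          case False
          have a: "a - e \<noteq> v - w" "a + b - e \<noteq> v + w" if "v \<in> W" "w \<in> W" for v w
          proof -
            have "a \<noteq> e + (v - w)" "a \<noteq> v + w - b + e"
              using False that F(1) by (auto simp: S_def T_def)
            then show "a - e \<noteq> v - w" "a + b - e \<noteq> v + w" by (auto simp: algebra_simps)
          qed
          have b: "b - e \<noteq> v - w" if "v \<in> W" "w \<in> W" for v w
          proof -
            have "b \<noteq> e + (v - w)" using bS G(1) that by (auto simp: S_def)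
            then show ?thesis by (auto simp: algebra_simps)
          qed
          have out: "K x = c x" if "K \<in> ?I d" "x \<notin> W" for K d x
            using that by (simp add: invariant_extensions_def extensions_def)
          have inv: "K (d - x) = K x" if "K \<in> ?I d" for K d x
            using that by (simp add: invariant_extensions_def)
          have "F = G"
          proof (rule reflections_agree[where a = a and b = b and e = e and H = H and W = W])
            show "a \<noteq> v + w" "b \<noteq> v + w" if "v \<in> W" "w \<in> W" for v w
              using F(1) G(1) that by (auto simp: ok_def)
            show "F x = H x" "G x = H x" if "x \<notin> W" for x
              using out[OF F(2) that] out[OF G(2) that] out[OF H(2) that] by simp_all
          qed (use inv[OF F(2)] inv[OF G(2)] inv[OF H(2)] a b in simp_all)
          then show ?thesis by blast
        qed
      qed
      then have "card R \<le> card (US \<union> {G} \<union> UT)"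
        by (rule card_mono[rotated]) (simp add: US UT)
      also have "\<dots> \<le> (card W)\<^sup>2 + 1 + (card W)\<^sup>2"
        using US UT by (intro order_trans[OF card_Un_le] add_mono) auto
      finally show ?thesis by simp
    qed
  qed
  then show ?thesis by (simp add: R_def)
qed

lemma card_large_order_rotations:
  fixes W :: "circle set"
  assumes W: "finite W"
  shows "card {F \<in> extensions W c. \<exists>t. (\<forall>k\<in>{1..2 * card W}. real k * t \<notin> \<int>)
           \<and> (\<forall>x. F (x + abs_circle t) = F x)} \<le> 1" (is "card ?R \<le> 1")
proof -
  have "F = G" if FR: "F \<in> ?R" and GR: "G \<in> ?R" for F G
  proof -
    obtain s where s: "\<forall>k\<in>{1..2 * card W}. real k * s \<notin> \<int>" "\<forall>x. F (x + abs_circle s) = F x"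
      using FR by blast
    obtain t where t: "\<forall>k\<in>{1..2 * card W}. real k * t \<notin> \<int>" "\<forall>x. G (x + abs_circle t) = G x"
      using GR by blast
    have FG: "F x = G x" if "x \<notin> W" for x
      using FR GR that by (simp add: extensions_def)
    show ?thesis
      by (rule large_order_rotations_agree[OF W order_refl, where s = s and t = t])
        (use s t FG in auto)
  qed
  moreover have "finite ?R" using finite_extensions[OF W] by simp
  ultimately show ?thesis by (metis (no_types, lifting) One_nat_def card_le_Suc0_iff_eq)
qed

text \<open>At most 16 parameters are doubles of points of \<open>W\<close>; their reflections fix
  at most two points, giving the exponent \<open>(16 + 2) div 2 = 9\<close>. The others come from
  the 120 pairs of distinct points, with exponent 8. The sum is
  \<open>16 * 2 ^ 9 + 120 * 2 ^ 8 = 38912\<close>.\<close>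

lemma card_reflections_in_sums:
  fixes W :: "circle set"
  assumes W: "finite W" "card W = 16"
  shows "card (\<Union>b\<in>{v + w |v w. v \<in> W \<and> w \<in> W}. invariant_extensions (\<lambda>x. b - x) W c) \<le> 38912"
proof -
  let ?I = "\<lambda>b. invariant_extensions (\<lambda>x. b - x) W c"
  let ?D = "(\<lambda>w. w + w) ` W"
  let ?P = "{P. P \<subseteq> W \<and> card P = 2}"
  \<comment> \<open>Removing the doubles ensures that reflections with parameter in \<open>S\<close>
    fix no point of \<open>W\<close>.\<close>
  define S where "S = (\<lambda>P. \<Sum>x\<in>P. x) ` ?P - ?D"
  have P: "finite ?P" using W(1) by simp
  have "card S \<le> card ((\<lambda>P. \<Sum>x\<in>P. x) ` ?P)" unfolding S_def using P by (intro card_mono) auto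
  also have "\<dots> \<le> card ?P" by (rule card_image_le[OF P])
  also have "\<dots> = 120" using n_subsets[OF W(1), of 2] W(2) by (simp add: choose_two)
  finally have S: "card S \<le> 120" .
  have ID: "card (?I b) \<le> 2 ^ 9" for b
  proof -
    have "(card W + card {w \<in> W. b - w = w}) div 2 \<le> 9"
      using card_reflection_fixpoints[OF W(1), of b] W(2) by linarith
    then have "(2::nat) ^ ((card W + card {w \<in> W. b - w = w}) div 2) \<le> 2 ^ 9"
      by (rule power_increasing) simp
    then show ?thesis by (rule order_trans[OF card_invariant_extensions_le[OF W(1)]])
  qed
  have IS: "card (?I b) \<le> 2 ^ 8" if "b \<in> S" for b
  proof -
    have none: "{w \<in> W. b - w = w} = {}" using that by (auto simp: S_def algebra_simps image_iff)
    show ?thesis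
      using card_invariant_extensions_le[OF W(1), of "\<lambda>x. b - x" c] W(2) unfolding none by simp
  qed
  have "(\<Union>b\<in>{v + w |v w. v \<in> W \<and> w \<in> W}. ?I b) \<subseteq> (\<Union>b\<in>?D. ?I b) \<union> (\<Union>b\<in>S. ?I b)"
  proof -
    have "b \<in> ?D \<or> b \<in> S" if "v \<in> W" "w \<in> W" "b = v + w" for b v w
    proof (cases "v = w")
      case True
      then show ?thesis using that by blast
    next
      case False
      then have "{v, w} \<in> ?P" "b = (\<Sum>x\<in>{v, w}. x)" using that by auto
      then have "b \<in> (\<lambda>P. \<Sum>x\<in>P. x) ` ?P" by blast
      then show ?thesis unfolding S_def by blast
    qed
    then have "{v + w |v w. v \<in> W \<and> w \<in> W} \<subseteq> ?D \<union> S" by blast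
    then have "(\<Union>b\<in>{v + w |v w. v \<in> W \<and> w \<in> W}. ?I b) \<subseteq> (\<Union>b\<in>?D \<union> S. ?I b)"
      by (rule UN_mono) simp
    then show ?thesis by (simp only: UN_Un)
  qed
  then have "card (\<Union>b\<in>{v + w |v w. v \<in> W \<and> w \<in> W}. ?I b)
      \<le> card ((\<Union>b\<in>?D. ?I b) \<union> (\<Union>b\<in>S. ?I b))"
    using W P by (intro card_mono) (auto intro: finite_invariant_extensions simp: S_def)
  also have "\<dots> \<le> card (\<Union>b\<in>?D. ?I b) + card (\<Union>b\<in>S. ?I b)" by (rule card_Un_le)
  also have "\<dots> \<le> 16 * 2 ^ 9 + 120 * 2 ^ 8"
  proof (rule add_mono)
    show "card (\<Union>b\<in>?D. ?I b) \<le> 16 * 2 ^ 9"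
      by (rule card_UN_le_mult[OF _ ID]) (use W card_image_le[OF W(1), of "\<lambda>w. w + w"] in auto)
    show "card (\<Union>b\<in>S. ?I b) \<le> 120 * 2 ^ 8"
      by (rule card_UN_le_mult[OF _ IS S]) (use P in \<open>auto simp: S_def\<close>)
  qed
  finally show ?thesis by simp
qed

lemma card_small_order_rotations:
  fixes W :: "circle set"
  assumes W: "finite W" "card W = 16"
  shows "card (\<Union>q\<in>{2..32}. invariant_extensions (\<lambda>x. x + abs_circle (1 / real q)) W c) \<le> 31 * 2 ^ 8"
proof (rule card_UN_le_mult)
  fix q :: nat assume q: "q \<in> {2..32}"
  have "1 / real q \<notin> \<int>"
  proof
    assume "1 / real q \<in> \<int>"
    then obtain z :: int where "1 / real q = of_int z" by (auto elim: Ints_cases)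
    moreover have "0 < 1 / real q" "1 / real q < 1" using q by auto
    ultimately show False by simp
  qed
  then have none: "{w \<in> W. w + abs_circle (1 / real q) = w} = {}" by (simp add: abs_circle_eq_0_iff)
  show "card (invariant_extensions (\<lambda>x. x + abs_circle (1 / real q)) W c) \<le> 2 ^ 8"
    using card_invariant_extensions_le[OF W(1), of "\<lambda>x. x + abs_circle (1 / real q)" c] W(2)
    unfolding none by simp
qed simp_all

text \<open>Otherwise every extension is preserved by a reflection with parameter in
  \<open>W + W\<close> (\<open>?R1\<close>) or outside it (\<open>?R2\<close>), or by a nontrivial
  rotation of order at most 32 (\<open>?R3\<close>) or of larger, possibly infinite, order
  (\<open>?R4\<close>).\<close>

lemma exists_distinguishing_extension:
  fixes W :: "circle set"
  assumes W: "card W = 16"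
  shows "\<exists>F\<in>extensions W c. distinguishing circle_automorphisms UNIV F"
proof (rule ccontr)
  assume none: "\<not> ?thesis"
  have fin: "finite W" using W card.infinite by fastforce
  let ?R1 = "\<Union>b\<in>{v + w |v w. v \<in> W \<and> w \<in> W}. invariant_extensions (\<lambda>x. b - x) W c"
  let ?R2 = "{F \<in> extensions W c.
           \<exists>b. (\<forall>v\<in>W. \<forall>w\<in>W. b \<noteq> v + w) \<and> (\<forall>x. F (b - x) = F x)}"
  let ?R3 = "\<Union>q\<in>{2..32}. invariant_extensions (\<lambda>x. x + abs_circle (1 / real q)) W c"
  let ?R4 = "{F \<in> extensions W c. \<exists>t. (\<forall>k\<in>{1..2 * card W}. real k * t \<notin> \<int>)
           \<and> (\<forall>x. F (x + abs_circle t) = F x)}"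
  have "extensions W c \<subseteq> (?R1 \<union> ?R2) \<union> (?R3 \<union> ?R4)"
  proof
    fix F assume F: "F \<in> extensions W c"
    with none obtain g where g: "g \<in> circle_automorphisms" "\<forall>x. F (g x) = F x"
        "\<not> is_identity_on UNIV g"
      by (auto simp: distinguishing_def)
    from g(1) consider b where "g = (\<lambda>x. b - x)" | a where "g = (\<lambda>x. x + a)"
      by (auto simp: circle_automorphisms_def)
    then show "F \<in> (?R1 \<union> ?R2) \<union> (?R3 \<union> ?R4)"
    proof cases
      case (1 b)
      show ?thesis
      proof (cases "\<forall>v\<in>W. \<forall>w\<in>W. b \<noteq> v + w")
        case True
        then have "F \<in> ?R2" using F g(2) 1 by blast
        then show ?thesis by blast
      next
        case False
        then have "F \<in> ?R1" using F g(2) 1 by (auto simp: invariant_extensions_def)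
        then show ?thesis by blast
      qed
    next
      case (2 a)
      obtain t where t: "a = abs_circle t" by (metis Quotient_circle Quotient_abs_rep)
      have inv: "F (x + abs_circle t) = F x" for x using g(2) 2 t by auto
      have tZ: "t \<notin> \<int>" using g(3) 2 t by (auto simp: is_identity_on_def abs_circle_eq_0_iff)
      show ?thesis
      proof (cases "\<forall>k\<in>{1..2 * card W}. real k * t \<notin> \<int>")
        case True
        then have "F \<in> ?R4" using F inv by blast
        then show ?thesis by blast
      next
        case False
        then obtain k where k: "k \<in> {1..32}" "real k * t \<in> \<int>" using W by auto
        then obtain q u v where q: "2 \<le> q" "q \<le> k" "of_int u * t + of_int v = 1 / real q"
          using rational_rotation_generator[of k t] tZ by auto
        have "abs_circle (1 / real q) = abs_circle (of_int u * t)"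
          by (simp add: abs_circle_eq_iff flip: q(3))
        then have "F (x + abs_circle (1 / real q)) = F x" for x
          using rotation_multiple[of F, OF inv] by metis
        then have "F \<in> invariant_extensions (\<lambda>x. x + abs_circle (1 / real q)) W c"
          using F by (simp add: invariant_extensions_def)
        moreover have "q \<in> {2..32}" using q k by simp
        ultimately have "F \<in> ?R3" by blast
        then show ?thesis by blast
      qed
    qed
  qed
  then have "card (extensions W c) \<le> card ((?R1 \<union> ?R2) \<union> (?R3 \<union> ?R4))"
    by (rule card_mono[rotated])
      (rule finite_subset[OF _ finite_extensions[OF fin, of c]], auto simp: invariant_extensions_def)
  \<comment> \<open>The bounds add up to 47362, against \<open>2 ^ 16 = 65536\<close>
    extensions.\<close>
  also have "\<dots> \<le> (38912 + (2 * (card W)\<^sup>2 + 1)) + (31 * 2 ^ 8 + 1)"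
    by (intro order_trans[OF card_Un_le] add_mono card_reflections_in_sums[OF fin W]
        card_reflections_outside_sums[OF fin] card_small_order_rotations[OF fin W]
        card_large_order_rotations[OF fin])
  finally show False using card_extensions[OF fin, of c] W by simp
qed

subsection \<open>Precolorings of the circle\<close>

text \<open>The condition on \<open>m\<close> inside \<open>ext_D\<close>, isolated so that an
  inequality between two values of \<open>ext_D\<close> follows from an implication holding for each
  \<open>m\<close>.\<close>

definition precolorings_extend :: "('a \<Rightarrow> 'a) set \<Rightarrow> 'a set \<Rightarrow> nat \<Rightarrow> bool" where
  "precolorings_extend \<Gamma> X m \<longleftrightarrow>
     (\<forall>W. fixing_set \<Gamma> X W \<and> (infinite W \<or> m \<le> card W) \<longrightarrow>
       (\<forall>c \<in> (X - W) \<rightarrow> colors \<Gamma> X.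
          \<exists>c' \<in> X \<rightarrow> colors \<Gamma> X. (\<forall>x \<in> X - W. c' x = c x) \<and> distinguishing \<Gamma> X c'))"

lemma ext_D_eq_Inf: "ext_D \<Gamma> X = Inf {enat m |m. precolorings_extend \<Gamma> X m}"
  by (simp add: ext_D_def precolorings_extend_def)

text \<open>A coloring with fewer than \<open>k\<close> colors takes values in
  \<open>{1..<k}\<close>, so refuting that single palette gives minimality of
  \<open>k\<close>.\<close>

lemma colors_eq_atLeastAtMost:
  assumes "c \<in> X \<rightarrow> {1..k}" "distinguishing \<Gamma> X c"
    and none: "\<And>c. c \<in> X \<rightarrow> {1..<k} \<Longrightarrow> \<not> distinguishing \<Gamma> X c"
  shows "colors \<Gamma> X = {1..k}"
proof -
  have "distinguishing_number \<Gamma> X = enat k"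
    unfolding distinguishing_number_def
  proof (rule antisym)
    show "Inf {enat k |k. \<exists>c\<in>X \<rightarrow> {1..k}. distinguishing \<Gamma> X c} \<le> enat k"
      using assms(1,2) by (intro Inf_lower) blast
    show "enat k \<le> Inf {enat k |k. \<exists>c\<in>X \<rightarrow> {1..k}. distinguishing \<Gamma> X c}"
    proof (intro Inf_greatest, clarify)
      fix j c assume "c \<in> X \<rightarrow> {1..j}" "distinguishing \<Gamma> X c"
      moreover have "c \<in> X \<rightarrow> {1..<k}" if "j < k" using calculation(1) that by fastforce
      ultimately show "enat k \<le> enat j" using none[of c] by fastforce
    qed
  qed
  then show ?thesis by (auto simp: colors_def)
qed

text \<open>Two colors suffice by the counting argument applied to a constant precoloring; a single
  color is preserved by the half turn.\<close>

lemma colors_circle: "colors circle_automorphisms UNIV = {1, 2}"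
proof -
  obtain S :: "circle set" where S: "card S = 16"
    using infinite_arbitrarily_large[OF infinite_circle] by blast
  obtain F where F: "F \<in> extensions S (\<lambda>_. 1)" "distinguishing circle_automorphisms UNIV F"
    using exists_distinguishing_extension[OF S] by blast
  have "colors circle_automorphisms UNIV = {1..2}"
  proof (rule colors_eq_atLeastAtMost[OF _ F(2)])
    show "F \<in> UNIV \<rightarrow> {1..2}"
    proof
      fix x show "F x \<in> {1..2}" using F(1) by (cases "x \<in> S") (auto simp: extensions_def)
    qed
    fix c :: "circle \<Rightarrow> nat" assume c12: "c \<in> UNIV \<rightarrow> {1..<2}"
    have c: "c x = 1" for x using funcset_mem[OF c12, of x] by simp
    have "(1/2 :: real) \<notin> \<int>"
    proof
      assume "(1/2 :: real) \<in> \<int>"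
      then obtain z :: int where z: "1/2 = real_of_int z" by (auto elim: Ints_cases)
      then have "real_of_int (2 * z) = 1" by simp
      then have "2 * z = 1" by linarith
      then show False by presburger
    qed
    then have "\<not> is_identity_on UNIV (\<lambda>x. x + abs_circle (1/2))"
      by (simp add: is_identity_on_def abs_circle_eq_0_iff)
    moreover have "(\<lambda>x. x + abs_circle (1/2)) \<in> circle_automorphisms"
      by (auto simp: circle_automorphisms_def)
    ultimately show "\<not> distinguishing circle_automorphisms UNIV c"
      using c by (auto simp: distinguishing_def)
  qed
  also have "{1..2} = {1, 2::nat}" by auto
  finally show ?thesis .
qed

lemma precolorings_extend_circle: "precolorings_extend circle_automorphisms UNIV 16"
  unfolding precolorings_extend_def colors_circle
proof (intro allI impI ballI)
  fix W :: "circle set" and c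
  assume W: "fixing_set circle_automorphisms UNIV W \<and> (infinite W \<or> 16 \<le> card W)"
    and c: "c \<in> UNIV - W \<rightarrow> {1, 2::nat}"
  obtain S where S: "S \<subseteq> W" "card S = 16"
    using W infinite_arbitrarily_large[of W 16] obtain_subset_with_card_n[of 16 W] by metis
  \<comment> \<open>The count concerns exactly 16 free points, so the remaining points of
    \<open>W\<close> are given color 1 in advance.\<close>
  define d where "d x = (if x \<in> W then 1 else c x)" for x
  obtain F where F: "F \<in> extensions S d" "distinguishing circle_automorphisms UNIV F"
    using exists_distinguishing_extension[OF S(2)] by blast
  have "F \<in> UNIV \<rightarrow> {1, 2}"
  proof
    fix x show "F x \<in> {1, 2}"
      using F(1) c by (cases "x \<in> S") (auto simp: extensions_def d_def)
  qed
  moreover have "\<forall>x\<in>UNIV - W. F x = c x" using F(1) S(1) by (auto simp: extensions_def d_def)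
  ultimately show "\<exists>c'\<in>UNIV \<rightarrow> {1, 2}.
      (\<forall>x\<in>UNIV - W. c' x = c x) \<and> distinguishing circle_automorphisms UNIV c'"
    using F(2) by blast
qed

text \<open>Two points a quarter turn apart form a fixing set, but whichever way they are colored, the
  result is symmetric once all other points have the same color.\<close>

lemma precolorings_extend_circle_ge_3:
  assumes "precolorings_extend circle_automorphisms UNIV m"
  shows "3 \<le> m"
proof (rule ccontr)
  assume "\<not> 3 \<le> m"
  define p where "p = abs_circle (1/4)"
  have no: "(1/2 :: real) \<notin> \<int>" "(1/4 :: real) \<notin> \<int>"
  proof -
    have "real_of_int z \<noteq> 1/2" "real_of_int z \<noteq> 1/4" for z
    proof -
      have "2 * z \<noteq> 1" "4 * z \<noteq> 1" by presburger+
      then have "real_of_int (2 * z) \<noteq> 1" "real_of_int (4 * z) \<noteq> 1" by linarith+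
      then show "real_of_int z \<noteq> 1/2" "real_of_int z \<noteq> 1/4" by auto
    qed
    then show "(1/2 :: real) \<notin> \<int>" "(1/4 :: real) \<notin> \<int>" by (metis Ints_cases)+
  qed
  have p0: "p \<noteq> 0" using no by (simp add: p_def abs_circle_eq_0_iff)
  have pp: "p + p \<noteq> 0" using no by (simp add: p_def abs_circle_eq_0_iff flip: abs_circle_add)
  then have pm: "- p \<noteq> p" by (metis add.left_inverse)
  then have "fixing_set circle_automorphisms UNIV {0, p}"
    by (auto simp: fixing_set_def circle_automorphisms_def is_identity_on_def algebra_simps)
  moreover have "card {0, p} = 2" using p0 by simp
  moreover have "(\<lambda>_. 1) \<in> UNIV - {0, p} \<rightarrow> colors circle_automorphisms UNIV"
    by (auto simp: colors_circle)
  moreover have "m \<le> 2" using \<open>\<not> 3 \<le> m\<close> by simp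
  ultimately have "\<exists>F\<in>UNIV \<rightarrow> colors circle_automorphisms UNIV.
      (\<forall>x\<in>UNIV - {0, p}. F x = 1) \<and> distinguishing circle_automorphisms UNIV F"
    using assms[unfolded precolorings_extend_def, rule_format, of "{0, p}" "\<lambda>_. 1"] by simp
  then obtain F where F: "F \<in> UNIV \<rightarrow> {1, 2}" "\<forall>x\<in>UNIV - {0, p}. F x = 1"
      "distinguishing circle_automorphisms UNIV F"
    unfolding colors_circle by (elim bexE conjE)
  have out: "F x = 1" if "x \<noteq> 0" "x \<noteq> p" for x using F(2) that by simp
  have not_id: "\<not> is_identity_on UNIV (\<lambda>x. b - x)" for b :: circle
  proof
    assume "is_identity_on UNIV (\<lambda>x. b - x)"
    then have "b - x = x" for x by (simp add: is_identity_on_def)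
    from this[of 0] this[of p] show False using pm by simp
  qed
  have moved: "\<exists>x. F (b - x) \<noteq> F x" for b
    using F(3) not_id[of b] by (auto simp: distinguishing_def circle_automorphisms_def)
  have "F 0 \<in> {1, 2}" "F p \<in> {1, 2}" using F(1) by auto
  \<comment> \<open>With two colors, either both points agree or one of them has the background
    color 1. The preserving reflections exchange 0 and \<open>p\<close>, fix \<open>p\<close>, and
    fix 0, respectively.\<close>
  then consider "F 0 = F p" | "F 0 = 1" | "F p = 1" by auto
  then show False
  proof cases
    case 1
    have "F (p - x) = F x" for x
      by (cases "x = 0"; cases "x = p") (use 1 in \<open>simp_all add: out\<close>)
    then show False using moved[of p] by blast
  next
    case 2
    then have "F x = 1" if "x \<noteq> p" for x using out that by metis
    then have "F (p + p - x) = F x" for x by (cases "x = p") (simp_all add: diff_eq_eq)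
    then show False using moved[of "p + p"] by blast
  next
    case 3
    then have "F x = 1" if "x \<noteq> 0" for x using out that by metis
    then have "F (0 - x) = F x" for x by (cases "x = 0") simp_all
    then show False using moved[of 0] by blast
  qed
qed

subsection \<open>The cycle inside the circle\<close>

text \<open>Defined on all naturals, where it is additive and, for positive \<open>n\<close>,
  vanishes exactly at the multiples of \<open>n\<close>; arithmetic modulo \<open>n\<close> thereby
  becomes addition in the circle.\<close>

definition cycle_point :: "nat \<Rightarrow> nat \<Rightarrow> circle" where
  "cycle_point n u = abs_circle (real u / real n)"

lemma cycle_point_add: "cycle_point n (u + v) = cycle_point n u + cycle_point n v"
  by (simp add: cycle_point_def add_divide_distrib abs_circle_add)

lemma cycle_point_0: "cycle_point n 0 = 0"
  by (simp add: cycle_point_def abs_circle_0)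

lemma cycle_point_eq_iff:
  assumes "n > 0"
  shows "cycle_point n u = cycle_point n v \<longleftrightarrow> u mod n = v mod n"
proof -
  have "cycle_point n u = cycle_point n v \<longleftrightarrow> (real u - real v) / real n \<in> \<int>"
    by (simp add: cycle_point_def abs_circle_eq_iff diff_divide_distrib)
  also have "\<dots> \<longleftrightarrow> (\<exists>z. real_of_int (int u - int v) = real_of_int (int n * z))"
    using assms by (auto simp: Ints_def field_simps)
  also have "\<dots> \<longleftrightarrow> int n dvd int u - int v" by (simp only: of_int_eq_iff dvd_def)
  also have "\<dots> \<longleftrightarrow> u mod n = v mod n"
    by (metis mod_eq_dvd_iff of_nat_eq_iff zmod_int)
  finally show ?thesis .
qed

lemma cycle_point_inj: "u < n \<Longrightarrow> v < n \<Longrightarrow> cycle_point n u = cycle_point n v \<longleftrightarrow> u = v"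
  using cycle_point_eq_iff[of n u v] by simp

lemma cycle_point_eq_0_iff: "n > 0 \<Longrightarrow> cycle_point n u = 0 \<longleftrightarrow> n dvd u"
  using cycle_point_eq_iff[of n u 0] by (simp add: cycle_point_0 dvd_eq_mod_eq_0)

lemma cycle_point_mod: "n > 0 \<Longrightarrow> cycle_point n (u mod n) = cycle_point n u"
  by (simp add: cycle_point_eq_iff)

lemma cycle_point_self: "cycle_point n n = 0"
  by (cases "n = 0") (simp_all add: cycle_point_def abs_circle_0 abs_circle_eq_0_iff)

lemma cycle_adj_iff:
  assumes "u < n" "v < n"
  shows "cycle_adj n u v \<longleftrightarrow> cycle_point n v = cycle_point n u + cycle_point n 1
    \<or> cycle_point n u = cycle_point n v + cycle_point n 1"
  using assms cycle_point_eq_iff[of n v "u + 1"] cycle_point_eq_iff[of n u "v + 1"]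
  by (simp add: cycle_adj_def flip: cycle_point_add)

text \<open>Consecutive vertices have images differing by \<open>?e\<close> or \<open>- ?e\<close>.
  The sign never changes, since a reversal would give \<open>u\<close> and \<open>u + 2\<close> the
  same image. A constant sign yields a rotation or a reflection.\<close>

lemma cycle_automorphismE:
  assumes n: "n \<ge> 3" and f: "f \<in> cycle_automorphisms n"
  obtains g where "g \<in> circle_automorphisms" "\<And>u. u < n \<Longrightarrow> cycle_point n (f u) = g (cycle_point n u)"
proof -
  let ?p = "cycle_point n" and ?e = "cycle_point n 1"
  have perm: "f permutes {0..<n}"
    using f by (simp add: cycle_automorphisms_def graph_automorphisms_def cycle_vertices_def)
  have adj: "cycle_adj n (f u) (f v) \<longleftrightarrow> cycle_adj n u v" if "u < n" "v < n" for u v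
    using f that by (auto simp: cycle_automorphisms_def graph_automorphisms_def cycle_vertices_def)
  have fn: "f u < n" if "u < n" for u using permutes_in_image[OF perm, of u] that by simp
  have step: "?p (f (Suc u)) = ?p (f u) + ?e \<or> ?p (f (Suc u)) = ?p (f u) - ?e" if "Suc u < n" for u
  proof -
    have "cycle_adj n u (Suc u)" using that by (simp add: cycle_adj_def)
    then have "cycle_adj n (f u) (f (Suc u))" using adj that by simp
    then show ?thesis using cycle_adj_iff[of "f u" n "f (Suc u)"] fn that
      by (auto simp: algebra_simps)
  qed
  have turn: "?p (f (Suc (Suc u))) \<noteq> ?p (f u)" if "Suc (Suc u) < n" for u
  proof
    assume "?p (f (Suc (Suc u))) = ?p (f u)"
    then have "f (Suc (Suc u)) = f u" using cycle_point_inj[OF fn[OF that] fn[of u]] that by simp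
    then show False using permutes_inj[OF perm] by (simp add: inj_eq)
  qed
  have "\<exists>d. (d = ?e \<or> d = - ?e) \<and> ?p (f 1) = ?p (f 0) + d"
    using step[of 0] n by (auto intro: exI[of _ "- ?e"])
  then obtain d where d: "d = ?e \<or> d = - ?e" "?p (f 1) = ?p (f 0) + d" by blast
  have const: "?p (f (Suc u)) = ?p (f u) + d" if "Suc u < n" for u
    using that
  proof (induction u)
    case 0
    then show ?case using d by simp
  next
    case (Suc u)
    then show ?case using step[of "Suc u"] turn[of u] d(1) by auto
  qed
  from d(1) show thesis
  proof
    assume de: "d = ?e"
    have eq: "?p (f u) = ?p u + ?p (f 0)" if "u < n" for u
      using that
    proof (induction u)
      case (Suc u)
      then show ?case using const[of u] cycle_point_add[of n u 1] by (simp add: de ac_simps)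
    qed (simp add: cycle_point_0)
    have "(\<lambda>x. x + ?p (f 0)) \<in> circle_automorphisms" unfolding circle_automorphisms_def by blast
    then show thesis by (rule that) (rule eq)
  next
    assume de: "d = - ?e"
    have eq: "?p (f u) = ?p (f 0) - ?p u" if "u < n" for u
      using that
    proof (induction u)
      case (Suc u)
      then show ?case using const[of u] cycle_point_add[of n u 1] by (simp add: de algebra_simps)
    qed (simp add: cycle_point_0)
    have "(\<lambda>x. ?p (f 0) - x) \<in> circle_automorphisms" unfolding circle_automorphisms_def by blast
    then show thesis by (rule that) (rule eq)
  qed
qed

lemma circle_automorphism_inj: "g \<in> circle_automorphisms \<Longrightarrow> g x = g y \<longleftrightarrow> x = y"
  by (auto simp: circle_automorphisms_def)

lemma circle_automorphism_adj:
  assumes "g \<in> circle_automorphisms"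
  shows "(g y = g x + a \<or> g x = g y + a) \<longleftrightarrow> (y = x + a \<or> x = y + a)"
  using assms by (auto simp: circle_automorphisms_def algebra_simps)

text \<open>An injective self-map of the finite vertex set is a permutation, and adjacency, being a
  difference of plus or minus \<open>1/n\<close>, is respected by rotations and reflections.\<close>

lemma cycle_automorphism_of_circle:
  assumes n: "n \<ge> 3" and g: "g \<in> circle_automorphisms"
    and V: "\<And>u. u < n \<Longrightarrow> \<exists>v<n. cycle_point n v = g (cycle_point n u)"
  obtains f where "f \<in> cycle_automorphisms n" "\<And>u. u < n \<Longrightarrow> cycle_point n (f u) = g (cycle_point n u)"
proof -
  obtain h where h: "\<And>u. u < n \<Longrightarrow> h u < n \<and> cycle_point n (h u) = g (cycle_point n u)"
    using V by metis
  \<comment> \<open>The identity off the vertices, as \<open>permutes\<close> demands.\<close>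
  define f where "f u = (if u < n then h u else u)" for u
  have f: "f u < n" "cycle_point n (f u) = g (cycle_point n u)" if "u < n" for u
    using h that by (simp_all add: f_def)
  have "inj_on f {0..<n}"
  proof (rule inj_onI)
    fix u v assume uv: "u \<in> {0..<n}" "v \<in> {0..<n}" "f u = f v"
    then have "g (cycle_point n u) = g (cycle_point n v)" using f(2)[of u] f(2)[of v] by simp
    then show "u = v" using uv circle_automorphism_inj[OF g] cycle_point_inj by auto
  qed
  moreover have "f ` {0..<n} \<subseteq> {0..<n}" using f(1) by auto
  ultimately have "bij_betw f {0..<n} {0..<n}"
    by (simp add: bij_betw_def endo_inj_surj)
  then have "f permutes {0..<n}" by (rule bij_imp_permutes) (simp add: f_def)
  moreover have "cycle_adj n (f u) (f v) \<longleftrightarrow> cycle_adj n u v" if "u < n" "v < n" for u v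
    unfolding cycle_adj_iff[OF f(1)[OF that(1)] f(1)[OF that(2)]] cycle_adj_iff[OF that]
      f(2)[OF that(1)] f(2)[OF that(2)]
    by (rule circle_automorphism_adj[OF g])
  ultimately have "f \<in> cycle_automorphisms n"
    by (auto simp: cycle_automorphisms_def graph_automorphisms_def cycle_vertices_def)
  then show thesis using that f(2) by blast
qed

text \<open>Lets all later arguments about the cycle use explicit rotations and reflections in place
  of graph automorphisms.\<close>

lemma distinguishing_cycle_iff:
  assumes n: "n \<ge> 3"
  shows "distinguishing (cycle_automorphisms n) (cycle_vertices n) c \<longleftrightarrow>
    (\<forall>g\<in>circle_automorphisms. (\<forall>u<n. \<exists>v<n. cycle_point n v = g (cycle_point n u) \<and> c v = c u)
       \<longrightarrow> (\<forall>u<n. g (cycle_point n u) = cycle_point n u))" (is "?D \<longleftrightarrow> ?C")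
proof
  assume D: ?D
  show ?C
  proof (intro ballI impI allI)
    fix g u assume g: "g \<in> circle_automorphisms" and u: "u < n"
      and V: "\<forall>u<n. \<exists>v<n. cycle_point n v = g (cycle_point n u) \<and> c v = c u"
    obtain f where f: "f \<in> cycle_automorphisms n"
      and fg: "\<And>u. u < n \<Longrightarrow> cycle_point n (f u) = g (cycle_point n u)"
      using cycle_automorphism_of_circle[OF n g] V by metis
    have fn: "f u < n" if "u < n" for u
      using f permutes_in_image[of f "{0..<n}" u] that
      by (simp add: cycle_automorphisms_def graph_automorphisms_def cycle_vertices_def)
    have "c (f u) = c u" if u: "u < n" for u
      using V u fg[OF u] fn[OF u] cycle_point_inj by metis
    then have "f u = u"
      using D f u by (auto simp: distinguishing_def is_identity_on_def cycle_vertices_def)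
    then show "g (cycle_point n u) = cycle_point n u" using fg[OF u] by simp
  qed
next
  assume C: ?C
  show ?D
    unfolding distinguishing_def
  proof (intro ballI impI)
    fix f assume f: "f \<in> cycle_automorphisms n" and c: "\<forall>u\<in>cycle_vertices n. c (f u) = c u"
    obtain g where g: "g \<in> circle_automorphisms"
      and fg: "\<And>u. u < n \<Longrightarrow> cycle_point n (f u) = g (cycle_point n u)"
      using cycle_automorphismE[OF n f] by metis
    have fn: "f u < n" if "u < n" for u
      using f permutes_in_image[of f "{0..<n}" u] that
      by (simp add: cycle_automorphisms_def graph_automorphisms_def cycle_vertices_def)
    have "\<forall>u<n. \<exists>v<n. cycle_point n v = g (cycle_point n u) \<and> c v = c u"
    proof (intro allI impI)
      fix u assume u: "u < n"
      show "\<exists>v<n. cycle_point n v = g (cycle_point n u) \<and> c v = c u"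
        using fn[OF u] fg[OF u] c u by (auto simp: cycle_vertices_def)
    qed
    then have "g (cycle_point n u) = cycle_point n u" if "u < n" for u using C g that by blast
    then have "f u = u" if "u < n" for u using fg fn cycle_point_inj that by metis
    then show "is_identity_on (cycle_vertices n) f"
      by (simp add: is_identity_on_def cycle_vertices_def)
  qed
qed

section \<open>Criteria for distinguishing colorings of the cycle\<close>

text \<open>A vertex that is alone in its color is fixed by every color-preserving symmetry. A
  rotation with a fixed point is trivial, and a reflection fixing both \<open>x\<close> and
  \<open>y\<close> would make their doubles equal.\<close>

lemma distinguishing_cycleI:
  assumes n: "n \<ge> 3" and x: "x < n" "\<And>u. u < n \<Longrightarrow> c u = c x \<Longrightarrow> u = x"
    and y: "y < n" "\<And>u. u < n \<Longrightarrow> c u = c y \<Longrightarrow> u = y"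
    and xy: "cycle_point n x + cycle_point n x \<noteq> cycle_point n y + cycle_point n y"
  shows "distinguishing (cycle_automorphisms n) (cycle_vertices n) c"
  unfolding distinguishing_cycle_iff[OF n]
proof (intro ballI impI)
  fix g assume g: "g \<in> circle_automorphisms"
    and V: "\<forall>u<n. \<exists>v<n. cycle_point n v = g (cycle_point n u) \<and> c v = c u"
  have "g (cycle_point n x) = cycle_point n x" using V x by metis
  moreover have "g (cycle_point n y) = cycle_point n y" using V y by metis
  ultimately show "\<forall>u<n. g (cycle_point n u) = cycle_point n u"
    using g xy by (auto simp: circle_automorphisms_def diff_eq_eq)
qed

text \<open>The reflection exchanging the elements of a color class with at most two elements preserves
  every coloring that uses only one further color.\<close>

lemma not_distinguishing_cycle:
  assumes n: "n \<ge> 3" and c: "c \<in> cycle_vertices n \<rightarrow> A" "card A = 2"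
    and k: "k \<in> A" "card {u. u < n \<and> c u = k} \<le> 2"
  shows "\<not> distinguishing (cycle_automorphisms n) (cycle_vertices n) c"
proof
  assume D: "distinguishing (cycle_automorphisms n) (cycle_vertices n) c"
  let ?p = "cycle_point n"
  let ?S = "{u. u < n \<and> c u = k}"
  obtain x y where xy: "x < n" "y < n" "?S = {} \<or> ?S = {x, y}"
  proof -
    consider "card ?S = 0" | "card ?S = 1" | "card ?S = 2" using k(2) by linarith
    then show thesis
    proof cases
      case 1
      then have "?S = {}" by simp
      then show thesis using that[of 0 0] n by simp
    next
      case 2
      then obtain x where "?S = {x}" by (auto simp: card_1_singleton_iff)
      then show thesis using that[of x x] by blast
    next
      case 3
      then obtain x y where "?S = {x, y}" by (auto simp: card_2_iff)
      then show thesis using that[of x y] by blast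
    qed
  qed
  define b where "b = ?p x + ?p y"
  \<comment> \<open>The summand \<open>n\<close> prevents truncation in the subtraction, since
    \<open>u < n\<close>.\<close>
  define r where "r u = (x + y + n - u) mod n" for u
  have r: "r u < n" "?p (r u) = b - ?p u" if "u < n" for u
  proof -
    show "r u < n" using n by (simp add: r_def)
    have "?p (r u) + ?p u = ?p (x + y + n - u + u)"
      unfolding r_def using n by (simp only: cycle_point_mod cycle_point_add)
    also have "\<dots> = b" using that by (simp add: b_def cycle_point_add cycle_point_self)
    finally show "?p (r u) = b - ?p u" by (simp add: algebra_simps)
  qed
  have rr: "r (r u) = u" if "u < n" for u
  proof -
    have "?p (r (r u)) = ?p u" using r that by simp
    then show ?thesis using r that cycle_point_inj by blast
  qed
  have rS: "r u \<in> ?S" if "u \<in> ?S" for u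
  proof -
    have S: "?S = {x, y}" using that xy(3) by blast
    then have uxy: "u = x \<or> u = y" using that by blast
    have u: "u < n" using that by blast
    have "?p (r u) = ?p x \<or> ?p (r u) = ?p y"
      unfolding r(2)[OF u] b_def using uxy by (elim disjE) simp_all
    then have "r u = x \<or> r u = y"
      using cycle_point_inj[OF r(1)[OF u] xy(1)] cycle_point_inj[OF r(1)[OF u] xy(2)] by simp
    then show ?thesis unfolding S by blast
  qed
  have "c (r u) = c u" if u: "u < n" for u
  proof (cases "c u = k")
    case True
    then show ?thesis using rS[of u] u by simp
  next
    case False
    have "c (r u) \<noteq> k" using rS[of "r u"] r(1)[OF u] rr[OF u] u False by auto
    moreover have "c (r u) \<in> A" "c u \<in> A" using c(1) r(1)[OF u] u by (auto simp: cycle_vertices_def)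
    ultimately show ?thesis using c(2) k(1) False by (auto simp: card_2_iff)
  qed
  then have "\<forall>u<n. \<exists>v<n. ?p v = b - ?p u \<and> c v = c u" using r by blast
  moreover have "(\<lambda>x. b - x) \<in> circle_automorphisms" unfolding circle_automorphisms_def by blast
  ultimately have fixp: "b - ?p u = ?p u" if "u < n" for u
    using D[unfolded distinguishing_cycle_iff[OF n], rule_format, of "\<lambda>x. b - x" u] that by simp
  have "b = ?p u + ?p u" if "u < n" for u using fixp[OF that] by (simp add: diff_eq_eq)
  \<comment> \<open>A reflection cannot fix the three distinct vertices 0, 1 and 2.\<close>
  from this[of 0] this[of 1] this[of 2] have "?p 0 = ?p 1 \<or> ?p 1 = ?p 2 \<or> ?p 0 = ?p 2"
    using n by (intro circle_half_unique) auto
  then show False using n cycle_point_inj[of _ n] by auto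
qed

text \<open>The vertices 0, 1, 3 cut the cycle into arcs of lengths 1, 2 and \<open>n - 3\<close>,
  pairwise distinct as \<open>n \<ge> 6\<close>, so only the identity preserves the
  triangle.\<close>

lemma distinguishing_scalene_triangle:
  assumes n: "n \<ge> 6"
  shows "distinguishing (cycle_automorphisms n) (cycle_vertices n) (\<lambda>u. if u \<in> {0, 1, 3} then 1 else 2)"
proof -
  have n3: "n \<ge> 3" using n by simp
  let ?p = "cycle_point n"
  define c :: "nat \<Rightarrow> nat" where "c = (\<lambda>u. if u \<in> {0, 1, 3} then 1 else 2)"
  have c1: "c u = 1 \<longleftrightarrow> u \<in> {0, 1, 3}" for u by (simp add: c_def)
  define e where "e = ?p 1"
  have p: "?p 0 = 0" "?p 1 = e" "?p 3 = e + e + e"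
    using cycle_point_add[of n 2 1] cycle_point_add[of n 1 1]
    by (simp_all add: e_def cycle_point_0 del: One_nat_def)
  \<comment> \<open>A nontrivial symmetry mapping the triangle into itself would make one of these
    five multiples of \<open>e\<close> vanish; for example, the reflection with parameter
    \<open>e\<close> could send the third corner to itself only if the fivefold multiple were
    0.\<close>
  have e: "e \<noteq> 0" "e + e \<noteq> 0" "e + e + e \<noteq> 0" "e + e + e + e \<noteq> 0" "e + e + e + e + e \<noteq> 0"
  proof -
    have "?p k \<noteq> 0" if "0 < k" "k < 6" for k
      using that n by (simp add: cycle_point_eq_0_iff nat_dvd_not_less)
    from this[of 1] this[of "1+1"] this[of "1+1+1"] this[of "1+1+1+1"] this[of "1+1+1+1+1"]
    show "e \<noteq> 0" "e + e \<noteq> 0" "e + e + e \<noteq> 0" "e + e + e + e \<noteq> 0" "e + e + e + e + e \<noteq> 0"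
      by (simp_all only: cycle_point_add e_def[symmetric]) simp_all
  qed
  have "distinguishing (cycle_automorphisms n) (cycle_vertices n) c"
    unfolding distinguishing_cycle_iff[OF n3]
  proof (intro ballI impI)
    fix g assume g: "g \<in> circle_automorphisms"
      and V: "\<forall>u<n. \<exists>v<n. ?p v = g (?p u) \<and> c v = c u"
    have T: "g (?p u) \<in> {0, e, e + e + e}" if "u \<in> {0, 1, 3}" for u
    proof -
      have "u < n" using that n by auto
      then obtain v where v: "?p v = g (?p u)" "c v = c u" using V by blast
      from v(2) that have "v \<in> {0, 1, 3}" by (simp only: c1[symmetric])
      then have "?p v \<in> {0, e, e + e + e}" using p by fastforce
      then show ?thesis by (simp only: v(1))
    qed
    have T3: "g 0 \<in> {0, e, e + e + e}" "g e \<in> {0, e, e + e + e}" "g (e + e + e) \<in> {0, e, e + e + e}"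
      using T[of 0] T[of 1] T[of 3] by (simp_all add: p del: One_nat_def)
    have ne: "0 \<noteq> e" "0 \<noteq> e + e" "0 \<noteq> e + e + e" "0 \<noteq> e + e + e + e" "0 \<noteq> e + e + e + e + e"
      using e by metis+
    from g show "\<forall>u<n. g (?p u) = ?p u"
      unfolding circle_automorphisms_def
    proof (elim UnE CollectE exE conjE)
      fix a assume ga: "g = (\<lambda>x. x + a)"
      then have "a = 0" using T3 e ne by (auto simp: algebra_simps)
      then show ?thesis using ga by simp
    next
      fix b assume "g = (\<lambda>x. b - x)"
      then have False using T3 e ne by (auto simp: algebra_simps)
      then show ?thesis ..
    qed
  qed
  then show ?thesis by (simp only: c_def)
qed

subsection \<open>Precolorings of the cycle\<close>

lemma colors_cycle_large:
  assumes n: "n \<ge> 6"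
  shows "colors (cycle_automorphisms n) (cycle_vertices n) = {1, 2}"
proof -
  have "colors (cycle_automorphisms n) (cycle_vertices n) = {1..2}"
  proof (rule colors_eq_atLeastAtMost[OF _ distinguishing_scalene_triangle[OF n]])
    fix c :: "nat \<Rightarrow> nat" assume c: "c \<in> cycle_vertices n \<rightarrow> {1..<2}"
    have none: "{u. u < n \<and> c u = 2} = {}" using funcset_mem[OF c] by (fastforce simp: cycle_vertices_def)
    have n3: "n \<ge> 3" using n by simp
    have c12: "c \<in> cycle_vertices n \<rightarrow> {1, 2}" using c by (auto simp: Pi_iff)
    show "\<not> distinguishing (cycle_automorphisms n) (cycle_vertices n) c"
      by (rule not_distinguishing_cycle[OF n3 c12, of 2]) (simp_all add: none)
  qed auto
  also have "{1..2} = {1, 2::nat}" by auto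
  finally show ?thesis .
qed

text \<open>Two colors on at most five vertices leave a class of at most two vertices, which
  \<open>not_distinguishing_cycle\<close> excludes. Three colors suffice: two adjacent vertices get
  colors of their own.\<close>

lemma colors_cycle_small:
  assumes n: "3 \<le> n" "n \<le> 5"
  shows "colors (cycle_automorphisms n) (cycle_vertices n) = {1..3}"
proof -
  define d where "d u = (if u = 0 then 1 else if u = 1 then 2 else 3 :: nat)" for u :: nat
  have d: "u = 0" if "d u = d 0" for u
    using that by (simp add: d_def split: if_splits)
  have d': "u = 1" if "d u = d 1" for u
    using that by (simp add: d_def split: if_splits)
  have "cycle_point n 2 = cycle_point n 1 + cycle_point n 1"
    using cycle_point_add[of n 1 1] by (simp add: numeral_2_eq_2)
  moreover have "cycle_point n 2 \<noteq> 0" using n by (simp add: cycle_point_eq_0_iff nat_dvd_not_less)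
  ultimately have ne: "cycle_point n 0 + cycle_point n 0 \<noteq> cycle_point n 1 + cycle_point n 1"
    by (metis add_0 cycle_point_0)
  have "0 < n" "1 < n" using n by simp_all
  then have dist: "distinguishing (cycle_automorphisms n) (cycle_vertices n) d"
    by (intro distinguishing_cycleI[OF n(1) _ d _ d' ne])
  have "\<not> distinguishing (cycle_automorphisms n) (cycle_vertices n) c"
    if c: "c \<in> cycle_vertices n \<rightarrow> {1..<3::nat}" for c
  proof -
  have c12: "c \<in> cycle_vertices n \<rightarrow> {1, 2}" using c by (auto simp: Pi_iff)
  let ?S = "\<lambda>k. {u. u < n \<and> c u = k}"
  have "?S 1 \<inter> ?S 2 = {}" "?S 1 \<union> ?S 2 = {0..<n}"
    using c12 by (auto simp: cycle_vertices_def)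
  then have "card (?S 1) + card (?S 2) = n"
    using card_Un_disjoint[of "?S 1" "?S 2"] by simp
  then consider "card (?S 1) \<le> 2" | "card (?S 2) \<le> 2" using n by linarith
  then show ?thesis
    by cases (rule not_distinguishing_cycle[OF n(1) c12]; simp)+
  qed
  moreover have "d \<in> cycle_vertices n \<rightarrow> {1..3}" by (simp add: d_def)
  ultimately show ?thesis using dist by (intro colors_eq_atLeastAtMost)
qed

text \<open>In both cases \<open>distinguishing_cycleI\<close> is applied to two uniquely colored
  vertices. If the precoloring is constant, these are chosen in \<open>W\<close> and receive the two
  other colors. Otherwise two precolored vertices have different colors, which together with three
  points of \<open>W\<close> forces \<open>n = 5\<close>, and all of \<open>W\<close> receives a
  third color.\<close>

lemma precolorings_extend_cycle_small:
  assumes n: "3 \<le> n" "n \<le> 5" and m: "3 \<le> m"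
  shows "precolorings_extend (cycle_automorphisms n) (cycle_vertices n) m"
  unfolding precolorings_extend_def colors_cycle_small[OF n]
proof (intro allI impI ballI)
  let ?V = "cycle_vertices n" and ?p = "cycle_point n"
  fix W c
  assume W: "fixing_set (cycle_automorphisms n) ?V W \<and> (infinite W \<or> m \<le> card W)"
    and c: "c \<in> ?V - W \<rightarrow> {1..3::nat}"
  have V: "?V = {0..<n}" "finite ?V" "card ?V = n" by (simp_all add: cycle_vertices_def)
  have sub: "W \<subseteq> ?V" using W by (simp add: fixing_set_def)
  then have fin: "finite W" using V(2) finite_subset by blast
  then have W3: "3 \<le> card W" using W m by auto
  show "\<exists>c'\<in>?V \<rightarrow> {1..3}. (\<forall>x\<in>?V - W. c' x = c x) \<and> distinguishing (cycle_automorphisms n) ?V c'"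
  proof (cases "\<exists>a\<in>{1..3}. \<forall>x\<in>?V - W. c x = a")
    case True
    then obtain a where a: "a \<in> {1..3}" "\<forall>x\<in>?V - W. c x = a" by blast
    obtain i j :: nat where ij: "i \<in> {1..3}" "j \<in> {1..3}" "i \<noteq> j" "i \<noteq> a" "j \<noteq> a"
    proof -
      have "a = 1 \<or> a = 2 \<or> a = 3" using a(1) by auto
      then show thesis using that[of 1 2] that[of 1 3] that[of 2 3] by auto
    qed
    \<comment> \<open>Three points cannot all have the same double.\<close>
    obtain x y where xy: "x \<in> W" "y \<in> W" "?p x + ?p x \<noteq> ?p y + ?p y"
    proof -
      obtain S where S: "S \<subseteq> W" "card S = 3" by (rule obtain_subset_with_card_n[OF W3])
      then obtain x y z where S': "S = {x, y, z}" "x \<noteq> y" "y \<noteq> z" "x \<noteq> z" by (auto simp: card_3_iff)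
      then have W': "x \<in> W" "y \<in> W" "z \<in> W" using S(1) by auto
      then have "x < n" "y < n" "z < n" using sub by (auto simp: V(1))
      then have "?p x \<noteq> ?p y" "?p y \<noteq> ?p z" "?p x \<noteq> ?p z"
        using S'(2-4) by (simp_all add: cycle_point_inj)
      moreover note W'
      ultimately show thesis using that circle_half_unique[of "?p x" "?p y" "?p z"] by metis
    qed
    then have xy': "x < n" "y < n" "x \<noteq> y" using sub by (auto simp: V(1))
    define d where "d u = (if u = x then i else if u = y then j else a)" for u
    have dx: "u = x" if "d u = d x" for u
      using that ij by (simp add: d_def split: if_splits)
    have dy: "u = y" if "d u = d y" for u
      using that ij by (simp add: d_def split: if_splits)
    have "distinguishing (cycle_automorphisms n) ?V d"
      by (rule distinguishing_cycleI[OF n(1) xy'(1) dx xy'(2) dy xy(3)])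
    moreover have "d \<in> ?V \<rightarrow> {1..3}" using ij a(1) by (simp add: d_def)
    moreover have "\<forall>u\<in>?V - W. d u = c u" using a(2) xy by (auto simp: d_def)
    ultimately show ?thesis by blast
  next
    case False
    then have "\<not> (\<forall>x\<in>?V - W. c x = 1)" by (rule contrapos_nn) (intro bexI[of _ 1], simp_all)
    then obtain x where x: "x \<in> ?V - W" by blast
    have cx: "c x \<in> {1..3}" using c x(1) by blast
    then obtain y where y: "y \<in> ?V - W" "c y \<noteq> c x" using False by blast
    have cy: "c y \<in> {1..3}" using c y(1) by blast
    have "card (?V - W) = n - card W" using V sub fin by (simp add: card_Diff_subset)
    moreover have "card {x, y} \<le> card (?V - W)" using x y V by (intro card_mono) auto
    moreover have "x \<noteq> y" using y(2) by (rule contrapos_nn) simp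
    moreover from this have "card {x, y} = 2" by simp
    ultimately have n5: "n = 5" and "card {x, y} = card (?V - W)" using n W3 by auto
    then have xy: "?V - W = {x, y}" using card_subset_eq[of "?V - W" "{x, y}"] x y V by auto
    obtain k :: nat where k: "k \<in> {1..3}" "k \<noteq> c x" "k \<noteq> c y"
    proof -
      have "c x = 1 \<or> c x = 2 \<or> c x = 3" "c y = 1 \<or> c y = 2 \<or> c y = 3" using cx cy by auto
      then show thesis using that[of 1] that[of 2] that[of 3] by auto
    qed
    define d where "d u = (if u = x then c x else if u = y then c y else k)" for u
    have lt: "x < n" "y < n" using x y by (auto simp: V(1))
    \<comment> \<open>Doubling is injective modulo 5.\<close>
    have ne: "?p x + ?p x \<noteq> ?p y + ?p y"
    proof
      assume "?p x + ?p x = ?p y + ?p y"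
      then have "?p (x + x) = ?p (y + y)" by (simp add: cycle_point_add)
      then have "(x + x) mod 5 = (y + y) mod 5" using n5 by (simp add: cycle_point_eq_iff)
      moreover have "(z + z) mod 5 = (if z + z < 5 then z + z else z + z - 5)" if "z < n" for z
        using that n5 by (simp add: mod_if)
      ultimately have "(if x + x < 5 then x + x else x + x - 5) = (if y + y < 5 then y + y else y + y - 5)"
        using lt by simp
      then have "x = y" by (simp split: if_splits; presburger)
      then show False using y by simp
    qed
    have dx: "u = x" if "d u = d x" for u
      using that k y by (simp add: d_def split: if_splits)
    have dy: "u = y" if "d u = d y" for u
      using that k y by (simp add: d_def split: if_splits)
    have "distinguishing (cycle_automorphisms n) ?V d"
      by (rule distinguishing_cycleI[OF n(1) lt(1) dx lt(2) dy ne])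
    moreover have "d \<in> ?V \<rightarrow> {1..3}" using cx cy k by (simp add: d_def)
    moreover have "\<forall>u\<in>?V - W. d u = c u" using xy by (auto simp: d_def)
    ultimately show ?thesis by blast
  qed
qed

text \<open>A reflection fixes at most two points. This makes the image of a fixing set of the cycle
  a fixing set of the circle, once it is known to have three points.\<close>

lemma fixing_set_circle_of_card:
  fixes W :: "circle set"
  assumes "3 \<le> card W"
  shows "fixing_set circle_automorphisms UNIV W"
proof -
  obtain S where "S \<subseteq> W" "card S = 3" by (rule obtain_subset_with_card_n[OF assms])
  then obtain x y z where W: "x \<in> W" "y \<in> W" "z \<in> W" "x \<noteq> y" "y \<noteq> z" "x \<noteq> z"
    by (auto simp: card_3_iff)
  have "\<exists>w\<in>W. b - w \<noteq> w" for b
  proof (rule ccontr)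
    assume "\<not> (\<exists>w\<in>W. b - w \<noteq> w)"
    then have "b = w + w" if "w \<in> W" for w using that by (simp add: diff_eq_eq)
    then show False using W circle_half_unique[of x y z] by metis
  qed
  then show ?thesis
    using W(1) by (auto simp: fixing_set_def circle_automorphisms_def is_identity_on_def)
qed

text \<open>Giving all circle points off the cycle the same color turns every color-preserving automorphism
  of the cycle into a color-preserving automorphism of the circle.\<close>

lemma precolorings_extend_cycle_large:
  assumes n: "6 \<le> n" and m: "precolorings_extend circle_automorphisms UNIV m"
  shows "precolorings_extend (cycle_automorphisms n) (cycle_vertices n) m"
  unfolding precolorings_extend_def colors_cycle_large[OF n]
proof (intro allI impI ballI)
  let ?V = "cycle_vertices n" and ?p = "cycle_point n"
  fix W c
  assume W: "fixing_set (cycle_automorphisms n) ?V W \<and> (infinite W \<or> m \<le> card W)"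
    and c: "c \<in> ?V - W \<rightarrow> {1, 2::nat}"
  have V: "?V = {0..<n}" "finite ?V" by (simp_all add: cycle_vertices_def)
  have n3: "n \<ge> 3" using n by simp
  have sub: "W \<subseteq> ?V" using W by (simp add: fixing_set_def)
  then have fin: "finite W" using V(2) finite_subset by blast
  have inj: "inj_on ?p ?V" by (rule inj_onI) (simp add: V(1) cycle_point_inj)
  define q where "q = inv_into ?V ?p"
  have q: "q (?p u) = u" if "u \<in> ?V" for u unfolding q_def by (rule inv_into_f_f[OF inj that])
  have card: "card (?p ` W) = card W" using card_image inj inj_on_subset sub by blast
  then have Wm: "m \<le> card (?p ` W)" using W fin by simp
  have "fixing_set circle_automorphisms UNIV (?p ` W)"
    by (rule fixing_set_circle_of_card[OF order_trans[OF precolorings_extend_circle_ge_3[OF m] Wm]])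
  moreover define d where "d x = (if x \<in> ?p ` ?V then c (q x) else 1)" for x
  have "d x \<in> {1, 2}" if "x \<notin> ?p ` W" for x
  proof (cases "x \<in> ?p ` ?V")
    case True
    then obtain u where u: "u \<in> ?V" "x = ?p u" by blast
    then have "u \<in> ?V - W" using that by blast
    then have "c u \<in> {1, 2}" by (rule funcset_mem[OF c])
    then show ?thesis using u q by (simp add: d_def)
  qed (simp add: d_def)
  then have "d \<in> UNIV - ?p ` W \<rightarrow> {1, 2}" by blast
  ultimately obtain F where F: "F \<in> UNIV \<rightarrow> {1, 2}" "\<forall>x\<in>UNIV - ?p ` W. F x = d x"
      "distinguishing circle_automorphisms UNIV F"
    using m[unfolded precolorings_extend_def colors_circle, rule_format, of "?p ` W" d] Wm by blast
  have off: "F x = 1" if "x \<notin> ?p ` ?V" for x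
  proof -
    have "x \<notin> ?p ` W" using that sub by blast
    then show ?thesis using F(2) that by (simp add: d_def)
  qed
  have "distinguishing (cycle_automorphisms n) ?V (F \<circ> ?p)"
    unfolding distinguishing_cycle_iff[OF n3]
  proof (intro ballI impI)
    fix g assume g: "g \<in> circle_automorphisms"
      and gV: "\<forall>u<n. \<exists>v<n. ?p v = g (?p u) \<and> (F \<circ> ?p) v = (F \<circ> ?p) u"
    have "g ` ?p ` ?V \<subseteq> ?p ` ?V"
    proof (clarify)
      fix u assume "u \<in> ?V"
      then obtain v where "v < n" "?p v = g (?p u)" using gV by (auto simp: V(1))
      then show "g (?p u) \<in> ?p ` ?V" by (auto simp: V(1) image_iff intro: sym)
    qed
    moreover have "inj_on g (?p ` ?V)" using circle_automorphism_inj[OF g] by (simp add: inj_on_def)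
    \<comment> \<open>Since \<open>g\<close> permutes the finite set of cycle points, it also maps
      the complement into itself, where \<open>F\<close> is constantly 1.\<close>
    ultimately have img: "g ` ?p ` ?V = ?p ` ?V" using V(2) by (intro endo_inj_surj) simp_all
    have "F (g x) = F x" for x
    proof (cases "x \<in> ?p ` ?V")
      case True
      then obtain u where u: "u < n" "x = ?p u" by (auto simp: V(1))
      then obtain v where "?p v = g x" "F (?p v) = F x" using gV by auto
      then show ?thesis by simp
    next
      case False
      have "g x \<notin> ?p ` ?V"
      proof
        assume "g x \<in> ?p ` ?V"
        then have "g x \<in> g ` ?p ` ?V" by (simp only: img)
        then obtain y where "y \<in> ?p ` ?V" "g x = g y" by blast
        then show False using False circle_automorphism_inj[OF g] by simp
      qed
      then show ?thesis using off False by simp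
    qed
    then have "is_identity_on UNIV g" using F(3) g by (simp add: distinguishing_def)
    then show "\<forall>u<n. g (?p u) = ?p u" by (simp add: is_identity_on_def)
  qed
  moreover have "F \<circ> ?p \<in> ?V \<rightarrow> {1, 2}" using F(1) by auto
  moreover have "\<forall>u\<in>?V - W. (F \<circ> ?p) u = c u"
  proof
    fix u assume u: "u \<in> ?V - W"
    then have "?p u \<notin> ?p ` W" using inj_on_image_mem_iff[OF inj _ sub] by blast
    then show "(F \<circ> ?p) u = c u" using F(2) u q by (simp add: d_def)
  qed
  ultimately show "\<exists>c'\<in>?V \<rightarrow> {1, 2}.
      (\<forall>x\<in>?V - W. c' x = c x) \<and> distinguishing (cycle_automorphisms n) ?V c'"
    by blast
qed

theorem theorem7:
  fixes n :: nat
  assumes "n \<ge> 3"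
  shows "ext_D (cycle_automorphisms n) (cycle_vertices n)
           \<le> ext_D circle_automorphisms (UNIV :: circle set) \<and>
         ext_D circle_automorphisms (UNIV :: circle set) \<le> 16"
proof
  \<comment> \<open>Every \<open>m\<close> valid for the circle is at least 3, as the case
    \<open>n \<le> 5\<close> demands, and is valid for the cycle; the infimum for the cycle
    therefore runs over a larger set.\<close>
  have "precolorings_extend (cycle_automorphisms n) (cycle_vertices n) m"
    if "precolorings_extend circle_automorphisms UNIV m" for m
    using precolorings_extend_cycle_small[of n m] precolorings_extend_cycle_large[of n m] assms
      precolorings_extend_circle_ge_3[OF that] that by linarith
  then show "ext_D (cycle_automorphisms n) (cycle_vertices n) \<le> ext_D circle_automorphisms UNIV"
    unfolding ext_D_eq_Inf by (intro Inf_superset_mono) blast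
  have "ext_D circle_automorphisms (UNIV :: circle set) \<le> enat 16"
    unfolding ext_D_eq_Inf using precolorings_extend_circle by (intro Inf_lower) blast
  then show "ext_D circle_automorphisms (UNIV :: circle set) \<le> 16"
    by (simp add: numeral_eq_enat)
qed

end
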